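(* Let $N$ be a positive integer, $k$ a nonnegative integer and $\Omega\subset\mathbb{R}^{N}$ a domain. Let $T, A\colon\mathscr{C}^{k}(\Omega,\mathbb{R})\to\mathscr{C}(\Omega,\mathbb{R})$ be additive mappings such that $A(1)=0$ and \[ T\left(\frac{1}{f}\right)=-\frac{1}{f^{2}}T(f)+\frac{2}{f^{3}}A(f)^{2} \] holds for all $f\in\mathscr{C}^{k}(\Omega,\mathbb{R})$ for which $f(x)\neq 0$ for all $x\in\Omega$. Then there are continuous functions $b,c\in\mathscr{C}(\Omega,\mathbb{R}^{N})$ such that \[ \begin{array}{rcl} T(f)(x)&=&\langle f''(x)c(x),c(x)\rangle+\langle f'(x),b(x)\rangle\\[1mm] A(f)(x)&=&\langle f'(x),c(x)\rangle \end{array} \qquad\left(f\in\mathscr{C}^{k}(\Omega,\mathbb{R}),\ x\in\Omega\right). \] Further, if $k=1$, then necessarily $c\equiv 0$; and if $k=0$, then necessarily $b\equiv 0$ and $c\equiv 0$.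
   Context: A domain is a nonempty, open and connected set. $\mathscr{C}^{k}(\Omega,\mathbb{R})$ is the ring (pointwise operations) of real-valued $k$-times continuously differentiable functions on $\Omega$; $\mathscr{C}(\Omega,\mathbb{R}^{m})$ is the space of continuous $\mathbb{R}^m$-valued functions on $\Omega$. A mapping $T$ is additive if $T(f+g)=T(f)+T(g)$ for all $f,g$ (no linearity or continuity assumed). $1$ denotes the identically $1$ function and $A(f)^2$ is the pointwise square of $A(f)$. $f'(x)=\nabla f(x)\in\mathbb{R}^N$ is the gradient, $f''(x)$ the Hessian matrix, $\langle\cdot,\cdot\rangle$ the standard inner product of $\mathbb{R}^N$. If $k=1$ (so that $c\equiv 0$) the term containing $f''$ is read as $0$, and if $k=0$ (so that $b\equiv c\equiv 0$) all terms containing $f'$ or $f''$ are read as $0$. *)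

theory Defs
  imports "HOL-Analysis.Analysis" "HOL-Library.FuncSet"
begin

text \<open>
  Order-k continuous differentiability on an open set. Quantifying over all directions v
  is the same as asking for all partial derivatives.
\<close>

primrec Ck_on :: "nat \<Rightarrow> (real^'n \<Rightarrow> real) \<Rightarrow> (real^'n) set \<Rightarrow> bool" where
  "Ck_on 0 f \<Omega> \<longleftrightarrow> continuous_on \<Omega> f"
| "Ck_on (Suc k) f \<Omega> \<longleftrightarrow> (\<forall>x\<in>\<Omega>. f differentiable (at x)) \<and>
     (\<forall>v. Ck_on k (\<lambda>x. frechet_derivative f (at x) v) \<Omega>)"

text \<open>
  Functions with domain \<open>\<Omega>\<close> are total functions with the fixed junk value \<^const>\<open>undefined\<close>
  outside \<open>\<Omega>\<close>, so that equality of members of \<open>Ck k \<Omega>\<close> is equality on \<open>\<Omega>\<close>. Ring operations on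
  \<open>Ck k \<Omega>\<close> are therefore written with the restricted abstraction \<open>\<lambda>x\<in>\<Omega>. \<dots>\<close>. The junk value
  does not affect derivatives at points of an open \<open>\<Omega>\<close>. The space \<open>Ck 0 \<Omega>\<close> consists of the
  continuous functions.
\<close>

definition Ck :: "nat \<Rightarrow> (real^'n) set \<Rightarrow> (real^'n \<Rightarrow> real) set" where
  "Ck k \<Omega> = {f \<in> extensional \<Omega>. Ck_on k f \<Omega>}"

definition additive_Ck ::
    "nat \<Rightarrow> (real^'n) set \<Rightarrow> ((real^'n \<Rightarrow> real) \<Rightarrow> (real^'n \<Rightarrow> real)) \<Rightarrow> bool" where
  "additive_Ck k \<Omega> T \<longleftrightarrow>
     (\<forall>f\<in>Ck k \<Omega>. \<forall>g\<in>Ck k \<Omega>. T (\<lambda>x\<in>\<Omega>. f x + g x) = (\<lambda>x\<in>\<Omega>. T f x + T g x))"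

definition grad :: "(real^'n \<Rightarrow> real) \<Rightarrow> real^'n \<Rightarrow> real^'n" where
  "grad f x = (\<chi> i. frechet_derivative f (at x) (axis i 1))"

definition hessian :: "(real^'n \<Rightarrow> real) \<Rightarrow> real^'n \<Rightarrow> real^'n^'n" where
  "hessian f x = jacobian (grad f) (at x)"

lemma GDERIV_grad:
  assumes "f differentiable (at x)"
  shows "GDERIV f x :> grad f x"
proof -
  have d: "(f has_derivative frechet_derivative f (at x)) (at x)"
    using assms frechet_derivative_works by blast
  then have lin: "linear (frechet_derivative f (at x))"
    by (rule has_derivative_linear)
  have "frechet_derivative f (at x) h = h \<bullet> grad f x" for h
  proof -
    have "frechet_derivative f (at x) h
        = frechet_derivative f (at x) (\<Sum>i\<in>UNIV. (h $ i) *s axis i 1)"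
      by (simp add: basis_expansion)
    also have "\<dots> = (\<Sum>i\<in>UNIV. h $ i * frechet_derivative f (at x) (axis i 1))"
      by (simp add: linear_sum[OF lin] linear_cmul[OF lin] scalar_mult_eq_scaleR)
    finally show ?thesis
      by (simp add: grad_def inner_vec_def)
  qed
  then show ?thesis
    using d unfolding gderiv_def by presburger
qed

end

theory Submission
  imports Defs
begin

text \<open>
  Applying \<open>T\<close> to \<open>1 / f = 1 / (f + 1) + 1 / (f\<^sup>2 + f)\<close> and replacing \<open>f\<close> by \<open>f + 1\<close> and \<open>f + 2\<close>
  determines \<open>T (f\<^sup>2)\<close> and \<open>A (f\<^sup>2)\<close>; by polarisation \<open>A\<close> is a derivation and
  \<open>T (f g) = f T g + g T f + 2 A f A g\<close>. Both operators are therefore local.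
  They kill constants by a gliding hump argument that exploits the continuity of the images.
  If \<open>f\<close> has vanishing \<open>k\<close>-jet at \<open>a\<close>, multiplying it by a function that is homogeneous of degree 0
  about \<open>a\<close> and equal to 1 on a cone and to 0 on an opposite half-space gives a \<open>C\<^sup>k\<close> function \<open>h\<close>;
  approaching \<open>a\<close> inside the cone and inside the half-space shows \<open>T f a = T h a = 0\<close>.
  So only the Taylor polynomial of \<open>f\<close> at \<open>a\<close> matters, and there the Leibniz rules give the formulas.
\<close>

subsection \<open>Calculus of \<open>C\<^sup>k\<close> functions\<close>

text \<open>\<open>T\<close> and \<open>A\<close> are merely additive, so a priori they may act on
  constants through a discontinuous additive map of the reals, and nothing is known about limits of
  functions; the only analytic input is that each single image is continuous. Smoothness is the
  second obstacle: Hadamard's factorisation of a flat \<open>f\<close> into terms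
  \<open>(x - a) $ i * g i\<close> in general leaves the class \<open>C^k\<close>, so the product
  rules cannot be applied to its factors. A multiplier of degree 0, by contrast, keeps flat
  functions in the class. The partial fraction identity serves because it consists of inverses only
  and the square enters additively in one denominator; as all denominators must be nonzero, the
  algebra is done for positive functions and extended by differences. A derivation is the case of
  zero cross term, so results on \<open>T\<close> for a pair \<open>(T, A)\<close> apply to
  \<open>A\<close> through the pair \<open>(A, 0)\<close>. The cross term is also what makes
  \<open>T\<close> second order: a product of two factors vanishing at a point is sent there to
  \<open>2 A f A g\<close>, while \<open>A\<close> annihilates it, so products of three such factors
  are killed.\<close>

abbreviation pd :: "'n \<Rightarrow> (real^'n \<Rightarrow> real) \<Rightarrow> real^'n \<Rightarrow> real" where
  "pd i f \<equiv> \<lambda>x. frechet_derivative f (at x) (axis i 1)"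

lemma linear_axis_sum:
  fixes L :: "real^'n \<Rightarrow> real"
  assumes "linear L"
  shows "L v = (\<Sum>i\<in>UNIV. v $ i * L (axis i 1))"
proof -
  have "L v = L (\<Sum>i\<in>UNIV. (v $ i) *s axis i 1)"
    by (simp add: basis_expansion)
  also have "\<dots> = (\<Sum>i\<in>UNIV. v $ i * L (axis i 1))"
    by (simp add: linear_sum[OF assms] linear_cmul[OF assms] scalar_mult_eq_scaleR)
  finally show ?thesis .
qed

lemma frechet_derivative_axis_sum:
  assumes "f differentiable (at x)"
  shows "frechet_derivative f (at x) v = (\<Sum>i\<in>UNIV. v $ i * pd i f x)"
  by (rule linear_axis_sum[OF linear_frechet_derivative[OF assms]])

lemma frechet_derivative_cong_open:
  assumes "open \<Omega>" "x \<in> \<Omega>" "\<And>y. y \<in> \<Omega> \<Longrightarrow> f y = g y"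
  shows "frechet_derivative f (at x) = frechet_derivative g (at x)"
proof -
  have "(f has_derivative D) (at x) \<longleftrightarrow> (g has_derivative D) (at x)" for D
    using has_derivative_transform_within_open[OF _ assms(1,2)] assms(3) by metis
  then show ?thesis unfolding frechet_derivative_def by simp
qed

lemma differentiable_cong_open:
  assumes "open \<Omega>" "x \<in> \<Omega>" "\<And>y. y \<in> \<Omega> \<Longrightarrow> f y = g y"
  shows "f differentiable (at x) \<longleftrightarrow> g differentiable (at x)"
  using has_derivative_transform_within_open[OF _ assms(1,2)] assms(3)
  unfolding differentiable_def by metis

lemma Ck_on_cong:
  assumes "open \<Omega>" "\<And>x. x \<in> \<Omega> \<Longrightarrow> f x = g x"
  shows "Ck_on k f \<Omega> \<longleftrightarrow> Ck_on k g \<Omega>"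
  using assms(2)
proof (induction k arbitrary: f g)
  case 0
  then show ?case by (simp cong: continuous_on_cong)
next
  case (Suc k)
  have "Ck_on k (\<lambda>x. frechet_derivative f (at x) v) \<Omega> \<longleftrightarrow>
        Ck_on k (\<lambda>x. frechet_derivative g (at x) v) \<Omega>" for v
    by (rule Suc.IH) (simp add: frechet_derivative_cong_open[OF assms(1) _ Suc.prems])
  then show ?case
    using differentiable_cong_open[OF assms(1) _ Suc.prems] by simp
qed

lemma Ck_on_imp_continuous_on: "Ck_on k f \<Omega> \<Longrightarrow> continuous_on \<Omega> f"
  using differentiable_at_imp_differentiable_on[of \<Omega> f] differentiable_imp_continuous_on[of f \<Omega>]
  by (cases k) auto

lemma Ck_on_SucD: "Ck_on (Suc k) f \<Omega> \<Longrightarrow> Ck_on k f \<Omega>"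
proof (induction k arbitrary: f)
  case 0
  then show ?case using Ck_on_imp_continuous_on[of "Suc 0"] by simp
next
  case (Suc k)
  then show ?case by (metis Ck_on.simps(2))
qed

lemma Ck_on_mono: "Ck_on k f \<Omega> \<Longrightarrow> j \<le> k \<Longrightarrow> Ck_on j f \<Omega>"
proof (induction k)
  case (Suc k)
  then show ?case using Ck_on_SucD[of k f] le_Suc_eq by blast
qed simp

lemma Ck_on_subset: "Ck_on k f \<Omega> \<Longrightarrow> U \<subseteq> \<Omega> \<Longrightarrow> Ck_on k f U"
  by (induction k arbitrary: f) (auto intro: continuous_on_subset)

text \<open>\<open>frechet_derivative\<close> is a choice operator, so its values are compared with
  an explicit formula \<open>f'\<close> on \<open>\<Omega>\<close> only; openness of
  \<open>\<Omega>\<close> lets that equality propagate to all further derivatives.\<close>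

lemma Ck_on_SucI:
  assumes "open \<Omega>" "\<And>x. x \<in> \<Omega> \<Longrightarrow> (f has_derivative f' x) (at x)"
    and "\<And>v. Ck_on k (\<lambda>x. f' x v) \<Omega>"
  shows "Ck_on (Suc k) f \<Omega>"
proof -
  have "Ck_on k (\<lambda>x. frechet_derivative f (at x) v) \<Omega>" for v
  proof (subst Ck_on_cong[OF assms(1)])
    show "frechet_derivative f (at x) v = f' x v" if "x \<in> \<Omega>" for x
      using frechet_derivative_at[OF assms(2)[OF that]] by simp
  qed (rule assms(3))
  then show ?thesis using assms(2) by (auto simp: differentiable_def)
qed

lemma Ck_on_Suc_has_derivative:
  "Ck_on (Suc k) f \<Omega> \<Longrightarrow> x \<in> \<Omega> \<Longrightarrow> (f has_derivative frechet_derivative f (at x)) (at x)"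
  using frechet_derivative_works[of f] by simp

lemma Ck_on_const [simp]: "open \<Omega> \<Longrightarrow> Ck_on k (\<lambda>x. c) \<Omega>"
  by (induction k arbitrary: c) simp_all

lemma Ck_on_add:
  assumes "open \<Omega>" "Ck_on k f \<Omega>" "Ck_on k g \<Omega>"
  shows "Ck_on k (\<lambda>x. f x + g x) \<Omega>"
  using assms(2,3)
proof (induction k arbitrary: f g)
  case 0
  then show ?case by (simp add: continuous_on_add)
next
  case (Suc k)
  show ?case
    by (rule Ck_on_SucI[OF assms(1) has_derivative_add[OF Suc.prems[THEN Ck_on_Suc_has_derivative]]])
      (use Suc in auto)
qed

lemma Ck_on_mult:
  assumes "open \<Omega>" "Ck_on k f \<Omega>" "Ck_on k g \<Omega>"
  shows "Ck_on k (\<lambda>x. f x * g x) \<Omega>"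
  using assms(2,3)
proof (induction k arbitrary: f g)
  case 0
  then show ?case by (simp add: continuous_on_mult)
next
  case (Suc k)
  have 1: "Ck_on k (\<lambda>x. f x * frechet_derivative g (at x) v + frechet_derivative f (at x) v * g x) \<Omega>" for v
    using Suc.prems by (intro Ck_on_add[OF assms(1)] Suc.IH) (auto intro: Ck_on_SucD)
  show ?case
    by (rule Ck_on_SucI[OF assms(1) has_derivative_mult[OF Suc.prems[THEN Ck_on_Suc_has_derivative]] 1])
qed

lemma Ck_on_cmult: "open \<Omega> \<Longrightarrow> Ck_on k f \<Omega> \<Longrightarrow> Ck_on k (\<lambda>x. c * f x) \<Omega>"
  by (simp add: Ck_on_mult)

lemma Ck_on_diff:
  assumes "open \<Omega>" "Ck_on k f \<Omega>" "Ck_on k g \<Omega>"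
  shows "Ck_on k (\<lambda>x. f x - g x) \<Omega>"
  using Ck_on_add[OF assms(1,2) Ck_on_cmult[OF assms(1,3), of "-1"]] by simp

lemma Ck_on_sum:
  assumes "open \<Omega>" "\<And>i. i \<in> I \<Longrightarrow> Ck_on k (f i) \<Omega>"
  shows "Ck_on k (\<lambda>x. \<Sum>i\<in>I. f i x) \<Omega>"
  using assms(2) by (induction I rule: infinite_finite_induct) (auto simp: assms(1) Ck_on_add)

lemma Ck_on_linear:
  assumes "open \<Omega>" "bounded_linear f"
  shows "Ck_on k f \<Omega>"
proof (cases k)
  case 0
  then show ?thesis using assms(2) by (simp add: linear_continuous_on)
next
  case (Suc j)
  have "(f has_derivative f) (at x)" for x
    by (rule bounded_linear_imp_has_derivative[OF assms(2)])
  then show ?thesis unfolding Suc by (intro Ck_on_SucI[OF assms(1)]) (auto simp: assms(1))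
qed

lemma Ck_on_coord: "open \<Omega> \<Longrightarrow> Ck_on k (\<lambda>x. x $ i) \<Omega>"
  by (rule Ck_on_linear[OF _ bounded_linear_vec_nth])

lemma Ck_on_coord_diff: "open \<Omega> \<Longrightarrow> Ck_on k (\<lambda>x. (x - a) $ i) \<Omega>"
  using Ck_on_diff[OF _ Ck_on_coord Ck_on_const] by simp

lemma Ck_on_inverse:
  assumes "open \<Omega>" "Ck_on k f \<Omega>" "\<And>x. x \<in> \<Omega> \<Longrightarrow> f x \<noteq> 0"
  shows "Ck_on k (\<lambda>x. inverse (f x)) \<Omega>"
  using assms(2,3)
proof (induction k)
  case 0
  then show ?case by (auto intro: continuous_on_inverse)
next
  case (Suc k)
  note d = Ck_on_Suc_has_derivative[OF Suc.prems(1)]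
  have i: "Ck_on k (\<lambda>x. inverse (f x)) \<Omega>"
    using Suc by (auto intro: Ck_on_SucD simp del: Ck_on.simps)
  have "Ck_on k (\<lambda>x. - 1 * (inverse (f x) * frechet_derivative f (at x) v * inverse (f x))) \<Omega>" for v
    using Suc.prems i by (intro Ck_on_cmult Ck_on_mult assms(1)) auto
  then show ?case
    using Suc.prems(2)
    by (intro Ck_on_SucI[OF assms(1) Deriv.has_derivative_inverse[OF _ d]]) auto
qed

section \<open>Truncated powers and the norm, the building blocks of all cutoffs\<close>

lemma has_derivative_pos_power:
  fixes t :: real
  shows "((\<lambda>t. max 0 t ^ Suc (Suc m)) has_derivative (\<lambda>h. h * (real (Suc (Suc m)) * max 0 t ^ Suc m))) (at t)"
proof -
  have "((\<lambda>t. max 0 t ^ Suc (Suc m)) has_field_derivative (real (Suc (Suc m)) * max 0 t ^ Suc m)) (at t)"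
  proof (cases t "0::real" rule: linorder_cases)
    case less
    have "((\<lambda>t. 0) has_field_derivative 0) (at t)" by simp
    then have "((\<lambda>t. max 0 t ^ Suc (Suc m)) has_field_derivative 0) (at t)"
      by (rule has_field_derivative_transform_within_open[of _ _ _ "{..<0}"]) (use less in auto)
    then show ?thesis using less by simp
  next
    case greater
    have "((\<lambda>t. t ^ Suc (Suc m)) has_field_derivative (real (Suc (Suc m)) * t ^ Suc m)) (at t)"
      by (rule derivative_eq_intros refl | simp)+
    then have "((\<lambda>t. max 0 t ^ Suc (Suc m)) has_field_derivative (real (Suc (Suc m)) * t ^ Suc m)) (at t)"
      by (rule has_field_derivative_transform_within_open[of _ _ _ "{0<..}"]) (use greater in auto)
    then show ?thesis using greater by simp
  next
    case equal
    have "((\<lambda>h::real. max 0 h ^ Suc m) \<longlongrightarrow> max 0 0 ^ Suc m) (at 0)"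
      by (intro tendsto_intros)
    then have "((\<lambda>h::real. max 0 h ^ Suc m) \<longlongrightarrow> 0) (at 0)" by simp
    then have "((\<lambda>h::real. max 0 h ^ Suc (Suc m) / h) \<longlongrightarrow> 0) (at 0)"
      by (rule Lim_transform_eventually) (auto simp: eventually_at_filter max_def)
    then show ?thesis using equal by (simp add: DERIV_def)
  qed
  then show ?thesis
    unfolding has_field_derivative_def by (rule has_derivative_eq_rhs) (simp add: fun_eq_iff)
qed

text \<open>Each derivative lowers the exponent of the truncated power by one, and exponent 1 is
  still continuous.\<close>

lemma Ck_on_pos_power:
  assumes "open \<Omega>" "Ck_on k f \<Omega>" "k < m"
  shows "Ck_on k (\<lambda>x. max 0 (f x) ^ m) \<Omega>"
  using assms(2,3)
proof (induction k arbitrary: m)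
  case 0
  then show ?case by (auto intro!: continuous_intros)
next
  case (Suc k)
  from Suc.prems(2) obtain l where m: "m = Suc (Suc l)" and l: "k < Suc l"
    by (intro that[of "m - 2"]) linarith+
  note d = Ck_on_Suc_has_derivative[OF Suc.prems(1)]
  have "Ck_on k (\<lambda>x. frechet_derivative f (at x) v * (real (Suc (Suc l)) * max 0 (f x) ^ Suc l)) \<Omega>" for v
    using Suc.prems l by (intro Ck_on_mult Ck_on_cmult assms(1) Suc.IH) (auto intro: Ck_on_SucD)
  then show ?case unfolding m
    by (intro Ck_on_SucI[OF assms(1) has_derivative_compose[OF d has_derivative_pos_power]])
qed

text \<open>The derivative in direction \<open>v\<close> is \<open>(x - a) \<bullet> v\<close>
  divided by the norm itself, so smoothness of order \<open>k\<close> of the norm yields order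
  \<open>k + 1\<close>.\<close>

lemma Ck_on_norm_diff:
  fixes a :: "real^'n"
  shows "Ck_on k (\<lambda>x. norm (x - a)) (- {a})"
proof (induction k)
  case 0
  then show ?case by (auto intro!: continuous_intros)
next
  case (Suc k)
  have o: "open (- {a})" by auto
  have "Ck_on k (\<lambda>x. (x - a) \<bullet> v) (- {a})" for v
    using Ck_on_diff[OF o Ck_on_linear[OF o bounded_linear_inner_left] Ck_on_const[OF o]]
    by (simp add: inner_diff_left)
  moreover have "Ck_on k (\<lambda>x. inverse (norm (x - a))) (- {a})"
    by (rule Ck_on_inverse[OF o Suc.IH]) auto
  ultimately have "Ck_on k (\<lambda>x. (x - a) \<bullet> v * inverse (norm (x - a))) (- {a})" for v
    by (intro Ck_on_mult o)
  then have 1: "Ck_on k (\<lambda>x. v \<bullet> sgn (x - a)) (- {a})" for v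
    by (simp add: sgn_div_norm inner_commute mult.commute)
  have "((\<lambda>x. norm (x - a)) has_derivative (\<lambda>v. v \<bullet> sgn (x - a))) (at x)" if "x \<in> - {a}" for x
  proof -
    have "((\<lambda>x. x - a) has_derivative (\<lambda>v. v)) (at x)"
      by (auto intro!: derivative_eq_intros)
    from has_derivative_compose[OF this has_derivative_norm[of "x - a"]] that show ?thesis
      by simp
  qed
  then show ?case
    by (rule Ck_on_SucI[OF o _ 1])
qed

lemma Ck_on_norm_power2_diff:
  fixes a :: "real^'n"
  shows "open \<Omega> \<Longrightarrow> Ck_on k (\<lambda>x. (norm (x - a))\<^sup>2) \<Omega>"
  unfolding dot_square_norm[symmetric] inner_vec_def
  by (auto intro!: Ck_on_sum Ck_on_mult Ck_on_coord_diff simp del: vector_minus_component)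

lemma Ck_on_Suc_pd:
  fixes f :: "real^'n \<Rightarrow> real"
  assumes "open \<Omega>" "\<And>x. x \<in> \<Omega> \<Longrightarrow> f differentiable (at x)" "\<And>i. Ck_on k (pd i f) \<Omega>"
  shows "Ck_on (Suc k) f \<Omega>"
proof -
  have "Ck_on k (\<lambda>x. \<Sum>i\<in>UNIV. v $ i * pd i f x) \<Omega>" for v :: "real^'n"
    by (intro Ck_on_sum Ck_on_cmult assms)
  moreover have "(f has_derivative (\<lambda>v. \<Sum>i\<in>UNIV. v $ i * pd i f x)) (at x)" if "x \<in> \<Omega>" for x
    using frechet_derivative_works[of f "at x"] assms(2)[OF that]
    by (simp flip: frechet_derivative_axis_sum)
  ultimately show ?thesis
    by (intro Ck_on_SucI[OF assms(1)])
qed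

subsection \<open>Symmetry of second derivatives\<close>

text \<open>The mean value theorem is applied in direction \<open>i\<close> to a first difference in
  direction \<open>l\<close>, then in direction \<open>l\<close> to \<open>pd i f\<close>. The
  second difference is symmetric in \<open>i\<close> and \<open>l\<close>, so it is expressed by
  either mixed partial. The displaced points lie within \<open>2 * h\<close> of \<open>a\<close>,
  hence inside the ball of radius \<open>3 * h\<close>.\<close>

lemma double_difference_mean_value:
  fixes f :: "real^'n \<Rightarrow> real"
  assumes h: "h > 0" and ball: "ball a (3 * h) \<subseteq> \<Omega>"
    and C2: "Ck_on 2 f \<Omega>"
  shows "\<exists>y \<in> ball a (3 * h).
    f (a + h *\<^sub>R axis i 1 + h *\<^sub>R axis l 1) - f (a + h *\<^sub>R axis i 1) - f (a + h *\<^sub>R axis l 1) + f a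
      = h\<^sup>2 * pd l (pd i f) y"
proof -
  let ?e = "axis i 1 :: real^'n" and ?u = "axis l 1 :: real^'n"
  have inb: "a + s *\<^sub>R ?e + t *\<^sub>R ?u \<in> ball a (3 * h)" if "0 \<le> s" "s \<le> h" "0 \<le> t" "t \<le> h" for s t
  proof -
    have "norm (s *\<^sub>R ?e + t *\<^sub>R ?u) \<le> s + t"
      using norm_triangle_ineq[of "s *\<^sub>R ?e" "t *\<^sub>R ?u"] that by (simp add: norm_axis_1)
    moreover have "dist a (a + s *\<^sub>R ?e + t *\<^sub>R ?u) = norm (s *\<^sub>R ?e + t *\<^sub>R ?u)"
      by (metis add.assoc add_diff_cancel_left' dist_commute dist_norm)
    ultimately show ?thesis using that h by simp
  qed
  have d1: "f differentiable (at x)" "pd i f differentiable (at x)" if "x \<in> ball a (3 * h)" for x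
    using C2 that ball by (auto simp: numeral_2_eq_2)
  have path: "((\<lambda>t. g (p + t *\<^sub>R w)) has_derivative (\<lambda>r. r * frechet_derivative g (at (p + t *\<^sub>R w)) w)) (at t)"
    if "g differentiable (at (p + t *\<^sub>R w))" for g :: "real^'n \<Rightarrow> real" and p w t
  proof -
    have g: "(g has_derivative frechet_derivative g (at (p + t *\<^sub>R w))) (at (p + t *\<^sub>R w))"
      using that frechet_derivative_works by blast
    have "((\<lambda>t. p + t *\<^sub>R w) has_derivative (\<lambda>r. r *\<^sub>R w)) (at t)"
      by (auto intro!: derivative_eq_intros)
    from has_derivative_compose[OF this g] show ?thesis
      by (simp add: linear_cmul[OF linear_frechet_derivative[OF that]])
  qed
  let ?g = "\<lambda>t. f (a + h *\<^sub>R ?u + t *\<^sub>R ?e) - f (a + t *\<^sub>R ?e)"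
  have g': "(?g has_derivative (\<lambda>r. r * pd i f (a + h *\<^sub>R ?u + t *\<^sub>R ?e) - r * pd i f (a + t *\<^sub>R ?e))) (at t)"
    if "0 \<le> t" "t \<le> h" for t
    using inb[of t h] inb[of t 0] h that
    by (intro has_derivative_diff path d1) (auto simp: ac_simps)
  have "\<exists>t. t > 0 \<and> t < h \<and> ?g h - ?g 0 = (h - 0) * (pd i f (a + h *\<^sub>R ?u + t *\<^sub>R ?e) - pd i f (a + t *\<^sub>R ?e))"
  proof (rule MVT2[OF h])
    fix t assume "0 \<le> t" "t \<le> h"
    from g'[OF this] show "DERIV ?g t :> pd i f (a + h *\<^sub>R ?u + t *\<^sub>R ?e) - pd i f (a + t *\<^sub>R ?e)"
      unfolding has_field_derivative_def by (rule has_derivative_eq_rhs) (simp add: fun_eq_iff algebra_simps)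
  qed
  then obtain t where t: "t > 0" "t < h"
    and eq1: "?g h - ?g 0 = h * (pd i f (a + h *\<^sub>R ?u + t *\<^sub>R ?e) - pd i f (a + t *\<^sub>R ?e))"
    by auto
  let ?k = "\<lambda>s. pd i f ((a + t *\<^sub>R ?e) + s *\<^sub>R ?u)"
  have "\<exists>s. s > 0 \<and> s < h \<and> ?k h - ?k 0 = (h - 0) * pd l (pd i f) ((a + t *\<^sub>R ?e) + s *\<^sub>R ?u)"
  proof (rule MVT2[OF h])
    fix s assume s: "0 \<le> s" "s \<le> h"
    then have "a + t *\<^sub>R ?e + s *\<^sub>R ?u \<in> ball a (3 * h)" using inb[of t s] t by simp
    from path[OF d1(2)[OF this]]
    show "DERIV ?k s :> pd l (pd i f) ((a + t *\<^sub>R ?e) + s *\<^sub>R ?u)"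
      unfolding has_field_derivative_def by (rule has_derivative_eq_rhs) (simp add: fun_eq_iff)
  qed
  then obtain s where s: "s > 0" "s < h"
    and eq2: "?k h - ?k 0 = h * pd l (pd i f) ((a + t *\<^sub>R ?e) + s *\<^sub>R ?u)"
    by auto
  have "?g h - ?g 0 = h\<^sup>2 * pd l (pd i f) ((a + t *\<^sub>R ?e) + s *\<^sub>R ?u)"
    using eq1 eq2 by (simp add: ac_simps power2_eq_square)
  moreover have "a + t *\<^sub>R ?e + s *\<^sub>R ?u \<in> ball a (3 * h)" using inb[of t s] t s by simp
  ultimately show ?thesis by (intro bexI) (auto simp: algebra_simps)
qed

lemma pd_commute:
  fixes f :: "real^'n \<Rightarrow> real"
  assumes "open \<Omega>" "a \<in> \<Omega>" "Ck_on 2 f \<Omega>"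
  shows "pd l (pd i f) a = pd i (pd l f) a"
proof (rule ccontr)
  assume ne: "pd l (pd i f) a \<noteq> pd i (pd l f) a"
  \<comment> \<open>Half the gap: two equal values, each within \<open>e\<close> of one mixed
    partial at \<open>a\<close>, would force the gap to be smaller than itself.\<close>
  define e where "e = \<bar>pd l (pd i f) a - pd i (pd l f) a\<bar> / 2"
  have e: "e > 0" using ne by (simp add: e_def)
  have "continuous_on \<Omega> (pd l (pd i f))" "continuous_on \<Omega> (pd i (pd l f))"
    using assms(3) by (auto simp: numeral_2_eq_2)
  then have c: "isCont (pd l (pd i f)) a" "isCont (pd i (pd l f)) a"
    using assms continuous_on_eq_continuous_at by blast+
  obtain r1 where r1: "r1 > 0" "\<And>y. dist y a < r1 \<Longrightarrow> dist (pd l (pd i f) y) (pd l (pd i f) a) < e"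
    using c(1) e unfolding continuous_at_eps_delta by blast
  obtain r2 where r2: "r2 > 0" "\<And>y. dist y a < r2 \<Longrightarrow> dist (pd i (pd l f) y) (pd i (pd l f) a) < e"
    using c(2) e unfolding continuous_at_eps_delta by blast
  obtain r3 where r3: "r3 > 0" "ball a r3 \<subseteq> \<Omega>"
    using assms openE by blast
  define h where "h = min r1 (min r2 r3) / 3"
  have h: "h > 0" "3 * h \<le> r1" "3 * h \<le> r2" "3 * h \<le> r3" using r1 r2 r3 by (auto simp: h_def)
  then have b: "ball a (3 * h) \<subseteq> \<Omega>" using r3 by (meson dual_order.trans subset_ball)
  obtain y z where y: "y \<in> ball a (3 * h)" and z: "z \<in> ball a (3 * h)"
    and "h\<^sup>2 * pd l (pd i f) y = h\<^sup>2 * pd i (pd l f) z"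
    using double_difference_mean_value[OF h(1) b assms(3), of i l]
      double_difference_mean_value[OF h(1) b assms(3), of l i]
    by (auto simp: algebra_simps)
  then have "pd l (pd i f) y = pd i (pd l f) z" using h by simp
  moreover have "dist (pd l (pd i f) y) (pd l (pd i f) a) < e" "dist (pd i (pd l f) z) (pd i (pd l f) a) < e"
    using r1(2)[of y] r2(2)[of z] y z h by (auto simp: dist_commute)
  ultimately show False unfolding e_def dist_real_def by (auto simp: field_simps abs_if split: if_splits)
qed

subsection \<open>Flat functions and homogeneous multipliers\<close>

text \<open>Vanishing of the whole jet of order \<open>k\<close> at \<open>a\<close>, arranged along
  the recursion of \<open>Ck_on\<close> so that both unfold together in inductions.\<close>

primrec flat :: "nat \<Rightarrow> (real^'n \<Rightarrow> real) \<Rightarrow> real^'n \<Rightarrow> bool" where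
  "flat 0 f a \<longleftrightarrow> f a = 0"
| "flat (Suc k) f a \<longleftrightarrow> f a = 0 \<and> (\<forall>i. flat k (pd i f) a)"

text \<open>Off \<open>a\<close>, the partial derivatives of \<open>f\<close> of order \<open>j \<le> k\<close> are \<open>o(norm (x - a) ^ (m - j))\<close>.
  The orders of smoothness and of vanishing are separate indices because differentiating the other
  factor of a product lowers only the former. Only \<open>k \<le> m\<close> occurs, so \<open>m - 1\<close> never truncates.\<close>

primrec small :: "real^'n \<Rightarrow> (real^'n) set \<Rightarrow> nat \<Rightarrow> nat \<Rightarrow> (real^'n \<Rightarrow> real) \<Rightarrow> bool" where
  "small a \<Omega> 0 m f \<longleftrightarrow> continuous_on (\<Omega> - {a}) f \<and> ((\<lambda>x. f x / norm (x - a) ^ m) \<longlongrightarrow> 0) (at a)"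
| "small a \<Omega> (Suc k) m f \<longleftrightarrow> (\<forall>x\<in>\<Omega> - {a}. f differentiable (at x)) \<and>
     ((\<lambda>x. f x / norm (x - a) ^ m) \<longlongrightarrow> 0) (at a) \<and> (\<forall>i. small a \<Omega> k (m - 1) (pd i f))"

text \<open>Positive homogeneity of degree \<open>- p\<close> about \<open>a\<close>.\<close>

definition homog :: "nat \<Rightarrow> real^'n \<Rightarrow> (real^'n \<Rightarrow> real) \<Rightarrow> bool" where
  "homog p a g \<longleftrightarrow> (\<forall>x t. x \<noteq> a \<longrightarrow> t > 0 \<longrightarrow> g (a + t *\<^sub>R (x - a)) = g x / t ^ p)"

lemma flatD: "flat k f a \<Longrightarrow> f a = 0"
  by (cases k) auto

lemma smallD: "small a \<Omega> k m f \<Longrightarrow> ((\<lambda>x. f x / norm (x - a) ^ m) \<longlongrightarrow> 0) (at a)"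
  by (cases k) auto

lemma flat_cong:
  assumes "open \<Omega>" "a \<in> \<Omega>" "\<And>x. x \<in> \<Omega> \<Longrightarrow> f x = g x"
  shows "flat k f a \<longleftrightarrow> flat k g a"
  using assms(3)
proof (induction k arbitrary: f g)
  case 0
  then show ?case using assms(2) by simp
next
  case (Suc k)
  have "flat k (pd i f) a \<longleftrightarrow> flat k (pd i g) a" for i
    by (rule Suc.IH) (simp add: frechet_derivative_cong_open[OF assms(1) _ Suc.prems])
  then show ?case using Suc.prems[OF assms(2)] by simp
qed

lemma div_norm_power_tendsto_mono:
  fixes f :: "real^'n \<Rightarrow> real"
  assumes "((\<lambda>x. f x / norm (x - a) ^ m) \<longlongrightarrow> 0) (at a)" "j \<le> m"
  shows "((\<lambda>x. f x / norm (x - a) ^ j) \<longlongrightarrow> 0) (at a)"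
proof -
  have "((\<lambda>x. norm (x - a) ^ (m - j)) \<longlongrightarrow> norm (a - a) ^ (m - j)) (at a)"
    by (intro tendsto_intros)
  from tendsto_mult[OF assms(1) this]
  have "((\<lambda>x. f x / norm (x - a) ^ m * norm (x - a) ^ (m - j)) \<longlongrightarrow> 0) (at a)"
    by simp
  then show ?thesis
  proof (rule Lim_transform_eventually)
    show "\<forall>\<^sub>F x in at a. f x / norm (x - a) ^ m * norm (x - a) ^ (m - j) = f x / norm (x - a) ^ j"
      using assms(2) by (auto simp: eventually_at_filter power_diff)
  qed
qed

lemma small_cong:
  assumes "open \<Omega>" "a \<in> \<Omega>" "\<And>x. x \<in> \<Omega> - {a} \<Longrightarrow> f x = g x"
  shows "small a \<Omega> k m f \<longleftrightarrow> small a \<Omega> k m g"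
  using assms(3)
proof (induction k arbitrary: f g m)
  case 0
  have 1: "continuous_on (\<Omega> - {a}) f \<longleftrightarrow> continuous_on (\<Omega> - {a}) g"
    by (rule continuous_on_cong) (use 0 in auto)
  have "\<forall>\<^sub>F x in at a. x \<in> \<Omega> - {a}"
    using assms(1,2) unfolding eventually_at_topological by blast
  then have "\<forall>\<^sub>F x in at a. f x / norm (x - a) ^ m = g x / norm (x - a) ^ m"
    by eventually_elim (simp only: 0)
  then have 2: "((\<lambda>x. f x / norm (x - a) ^ m) \<longlongrightarrow> 0) (at a) \<longleftrightarrow> ((\<lambda>x. g x / norm (x - a) ^ m) \<longlongrightarrow> 0) (at a)"
    by (rule tendsto_cong)
  show ?case by (simp only: small.simps 1 2)
next
  case (Suc k)
  have o: "open (\<Omega> - {a})" using assms(1) by auto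
  have "\<forall>\<^sub>F x in at a. x \<in> \<Omega> - {a}"
    using assms(1,2) unfolding eventually_at_topological by blast
  then have "\<forall>\<^sub>F x in at a. f x / norm (x - a) ^ m = g x / norm (x - a) ^ m"
    by eventually_elim (simp only: Suc.prems)
  then have 1: "((\<lambda>x. f x / norm (x - a) ^ m) \<longlongrightarrow> 0) (at a) \<longleftrightarrow> ((\<lambda>x. g x / norm (x - a) ^ m) \<longlongrightarrow> 0) (at a)"
    by (rule tendsto_cong)
  have 2: "small a \<Omega> k (m - 1) (pd i f) \<longleftrightarrow> small a \<Omega> k (m - 1) (pd i g)" for i
    by (rule Suc.IH) (simp only: frechet_derivative_cong_open[OF o _ Suc.prems])
  have 3: "f differentiable (at x) \<longleftrightarrow> g differentiable (at x)" if "x \<in> \<Omega> - {a}" for x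
    by (rule differentiable_cong_open[OF o that Suc.prems])
  show ?case by (simp only: small.simps 1 2 3 cong: ball_cong)
qed

lemma small_SucD: "small a \<Omega> (Suc k) m f \<Longrightarrow> small a \<Omega> k m f"
proof (induction k arbitrary: f m)
  case 0
  then have "f differentiable_on (\<Omega> - {a})"
    using differentiable_at_imp_differentiable_on[of "\<Omega> - {a}" f] by simp
  then show ?case using 0 differentiable_imp_continuous_on by auto
next
  case (Suc k)
  have "small a \<Omega> k (m - 1) (pd i f)" for i
    using Suc.IH[of "m - 1" "pd i f"] Suc.prems by simp
  then show ?case using Suc.prems by simp
qed

lemma small_Suc_has_derivative:
  "small a \<Omega> (Suc k) m f \<Longrightarrow> x \<in> \<Omega> - {a} \<Longrightarrow> (f has_derivative frechet_derivative f (at x)) (at x)"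
  using frechet_derivative_works[of f] by simp

lemma small_add:
  assumes "open \<Omega>" "a \<in> \<Omega>" "small a \<Omega> k m f" "small a \<Omega> k m g"
  shows "small a \<Omega> k m (\<lambda>x. f x + g x)"
  using assms(3,4)
proof (induction k arbitrary: f g m)
  case 0
  then show ?case
    using tendsto_add[of "\<lambda>x. f x / norm (x - a) ^ m" 0 "at a" "\<lambda>x. g x / norm (x - a) ^ m" 0]
    by (auto simp: add_divide_distrib intro: continuous_on_add)
next
  case (Suc k)
  have 1: "((\<lambda>x. (f x + g x) / norm (x - a) ^ m) \<longlongrightarrow> 0) (at a)"
    using tendsto_add[of "\<lambda>x. f x / norm (x - a) ^ m" 0 "at a" "\<lambda>x. g x / norm (x - a) ^ m" 0] Suc.prems
    by (auto simp: add_divide_distrib)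
  have "small a \<Omega> k (m - 1) (pd i (\<lambda>x. f x + g x))" for i
  proof (subst small_cong[OF assms(1,2)])
    show "small a \<Omega> k (m - 1) (\<lambda>x. pd i f x + pd i g x)"
      using Suc by auto
    fix x assume "x \<in> \<Omega> - {a}"
    then have "frechet_derivative (\<lambda>x. f x + g x) (at x) = (\<lambda>v. frechet_derivative f (at x) v + frechet_derivative g (at x) v)"
      by (intro frechet_derivative_at[symmetric] has_derivative_add Suc.prems[THEN small_Suc_has_derivative])
    then show "pd i (\<lambda>x. f x + g x) x = pd i f x + pd i g x" by simp
  qed
  then show ?case using 1 Suc.prems by auto
qed

text \<open>A removable singularity: as long as one order of vanishing is left, \<open>f\<close> is
  \<open>o(norm (x - a))\<close>, which says that it has derivative 0 at \<open>a\<close>. The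
  partials then vanish at \<open>a\<close> too and the induction restarts with them; at order 0 the
  limit 0 is continuity.\<close>

lemma Ck_on_small:
  assumes "open \<Omega>" "a \<in> \<Omega>" "small a \<Omega> k m f" "k \<le> m" "f a = 0"
  shows "Ck_on k f \<Omega>"
  using assms(3-5)
proof (induction k arbitrary: f m)
  case 0
  have "(f \<longlongrightarrow> f a) (at a)"
    using div_norm_power_tendsto_mono[OF smallD[OF 0(1)], of 0] 0(3) by simp
  then have "isCont f a" by (simp add: isCont_def)
  moreover have "isCont f x" if "x \<in> \<Omega> - {a}" for x
    using 0(1) that assms(1) by (simp add: continuous_on_eq_continuous_at open_delete)
  ultimately show ?case using assms(1) by (auto simp: continuous_on_eq_continuous_at)
next
  case (Suc k)
  have "((\<lambda>x. f x / norm (x - a) ^ 1) \<longlongrightarrow> 0) (at a)"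
    using div_norm_power_tendsto_mono[OF smallD[OF Suc.prems(1)], of 1] Suc.prems(2) by simp
  then have "((\<lambda>x. norm (f x / norm (x - a))) \<longlongrightarrow> 0) (at a)"
    using tendsto_norm_zero by fastforce
  then have da: "(f has_derivative (\<lambda>h. 0)) (at a)"
    unfolding has_derivative_iff_norm using Suc.prems(3) by simp
  have d: "f differentiable (at x)" if "x \<in> \<Omega>" for x
    using da Suc.prems(1) that by (cases "x = a") (auto simp: differentiable_def)
  have "Ck_on k (pd i f) \<Omega>" for i
  proof (rule Suc.IH[of "m - 1"])
    show "pd i f a = 0" using frechet_derivative_at[OF da] by metis
  qed (use Suc.prems in auto)
  then show ?case by (intro Ck_on_Suc_pd[OF assms(1) d])
qed

text \<open>Integrating a decay rate of the partials gains one power of the norm: the mean value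
  inequality on the closed ball about \<open>a\<close> through \<open>x\<close> bounds
  \<open>f x\<close> by the operator norm of the derivative times
  \<open>norm (x - a)\<close>.\<close>

lemma primitive_tendsto:
  fixes f :: "real^'n \<Rightarrow> real"
  assumes "open \<Omega>" "a \<in> \<Omega>" and d: "\<And>x. x \<in> \<Omega> \<Longrightarrow> f differentiable (at x)"
    and "f a = 0" and pa: "\<And>i. pd i f a = 0"
    and lim: "\<And>i. ((\<lambda>x. pd i f x / norm (x - a) ^ k) \<longlongrightarrow> 0) (at a)"
  shows "((\<lambda>x. f x / norm (x - a) ^ Suc k) \<longlongrightarrow> 0) (at a)"
  unfolding tendsto_iff
proof (intro allI impI)
  fix e :: real assume e: "e > 0"
  \<comment> \<open>With each of the \<open>N\<close> partials below \<open>e / (2 * N)\<close>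
    times the power, the operator norm is at most \<open>e / 2\<close> times it; the factor 2 turns
    the final bound into a strict one.\<close>
  define N where "N = real CARD('n)"
  have N: "N > 0" by (simp add: N_def)
  have "\<forall>\<^sub>F x in at a. \<forall>i\<in>UNIV. dist (pd i f x / norm (x - a) ^ k) 0 < e / (2 * N)"
    using lim e N by (intro eventually_ball_finite) (auto simp: tendsto_iff)
  then obtain r1 where r1: "r1 > 0"
    "\<And>x i. x \<noteq> a \<Longrightarrow> dist x a < r1 \<Longrightarrow> \<bar>pd i f x / norm (x - a) ^ k\<bar> < e / (2 * N)"
    unfolding eventually_at by (auto simp: dist_real_def)
  obtain r2 where r2: "r2 > 0" "ball a r2 \<subseteq> \<Omega>" using assms(1,2) openE by blast
  have "\<bar>f x / norm (x - a) ^ Suc k\<bar> < e" if x: "x \<noteq> a" "dist x a < min r1 r2" for x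
  proof -
    let ?r = "norm (x - a)"
    have r: "?r > 0" using x by simp
    have sub: "cball a ?r \<subseteq> \<Omega>"
      using x r2 by (auto simp: dist_norm norm_minus_commute)
    have "norm (f x - f a) \<le> (e / 2 * ?r ^ k) * norm (x - a)"
    proof (rule differentiable_bound[OF convex_cball])
      fix y assume y: "y \<in> cball a ?r"
      then have yd: "f differentiable (at y)" using sub d by auto
      then show "(f has_derivative frechet_derivative f (at y)) (at y within cball a ?r)"
        using frechet_derivative_works has_derivative_at_withinI by blast
      have b: "\<bar>pd i f y\<bar> \<le> e / (2 * N) * ?r ^ k" for i
      proof (cases "y = a")
        case True
        then show ?thesis using pa e N by simp
      next
        case False
        have yr: "norm (y - a) \<le> ?r" using y by (simp add: dist_norm norm_minus_commute)
        then have "\<bar>pd i f y / norm (y - a) ^ k\<bar> < e / (2 * N)"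
          using r1(2)[of y i] False x by (auto simp: dist_norm)
        then have "\<bar>pd i f y\<bar> \<le> e / (2 * N) * norm (y - a) ^ k"
          using False by (simp add: abs_divide divide_less_eq)
        also have "\<dots> \<le> e / (2 * N) * ?r ^ k"
          using yr e N by (intro mult_left_mono power_mono) auto
        finally show ?thesis .
      qed
      show "onorm (frechet_derivative f (at y)) \<le> e / 2 * ?r ^ k"
      proof (rule onorm_le)
        fix v :: "real^'n"
        have "norm (frechet_derivative f (at y) v) \<le> (\<Sum>i\<in>UNIV. \<bar>v $ i * pd i f y\<bar>)"
          by (subst frechet_derivative_axis_sum[OF yd]) (simp only: real_norm_def sum_abs)
        also have "\<dots> \<le> (\<Sum>i\<in>(UNIV::'n set). norm v * (e / (2 * N) * ?r ^ k))"
          unfolding abs_mult by (intro sum_mono mult_mono b component_le_norm_cart) auto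
        also have "\<dots> = e / 2 * ?r ^ k * norm v"
          using N by (simp add: N_def)
        finally show "norm (frechet_derivative f (at y) v) \<le> e / 2 * ?r ^ k * norm v" .
      qed
    qed (auto simp: dist_norm norm_minus_commute)
    then have "\<bar>f x\<bar> \<le> e / 2 * ?r ^ Suc k" using \<open>f a = 0\<close> by (simp add: ac_simps)
    then have "\<bar>f x / ?r ^ Suc k\<bar> \<le> e / 2" using r by (simp add: abs_divide pos_divide_le_eq del: power_Suc)
    then show ?thesis using e by linarith
  qed
  then show "\<forall>\<^sub>F x in at a. dist (f x / norm (x - a) ^ Suc k) 0 < e"
    using r1 r2 by (auto simp: eventually_at dist_real_def simp del: power_Suc intro!: exI[of _ "min r1 r2"])
qed

text \<open>Peano's form of Taylor's theorem for all derivatives at once, built from the highest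
  order downwards by integrating the partials.\<close>

lemma flat_imp_small:
  assumes "open \<Omega>" "a \<in> \<Omega>" "Ck_on k f \<Omega>" "flat k f a"
  shows "small a \<Omega> k k f"
  using assms(3,4)
proof (induction k arbitrary: f)
  case 0
  then have "isCont f a" using assms(1,2) by (simp add: continuous_on_eq_continuous_at)
  then show ?case using 0 by (auto simp: isCont_def intro: continuous_on_subset)
next
  case (Suc k)
  have s: "small a \<Omega> k k (pd i f)" for i
    using Suc by auto
  moreover have "((\<lambda>x. f x / norm (x - a) ^ Suc k) \<longlongrightarrow> 0) (at a)"
    using Suc.prems by (intro primitive_tendsto[OF assms(1,2)] smallD[OF s]) (auto dest: flatD)
  ultimately show ?case using Suc.prems by auto
qed

section \<open>Positively homogeneous functions as multipliers\<close>

lemma homog_bounded: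
  fixes g :: "real^'n \<Rightarrow> real"
  assumes "homog p a g" "continuous_on (- {a}) g"
  obtains C where "\<And>x. x \<noteq> a \<Longrightarrow> \<bar>g x\<bar> * norm (x - a) ^ p \<le> C"
proof -
  have "compact (g ` sphere a 1)"
    using assms(2) by (intro compact_continuous_image) (auto intro: continuous_on_subset)
  then obtain C where C: "\<And>y. y \<in> sphere a 1 \<Longrightarrow> \<bar>g y\<bar> \<le> C"
    using compact_imp_bounded bounded_real by (metis image_eqI)
  have "\<bar>g x\<bar> * norm (x - a) ^ p \<le> C" if x: "x \<noteq> a" for x
  proof -
    let ?t = "1 / norm (x - a)"
    have "g (a + ?t *\<^sub>R (x - a)) = g x / ?t ^ p"
      using assms(1) x unfolding homog_def by simp
    then have "\<bar>g x\<bar> * norm (x - a) ^ p = \<bar>g (a + ?t *\<^sub>R (x - a))\<bar>"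
      by (simp add: power_divide abs_mult)
    also have "\<dots> \<le> C" using x by (intro C) (simp add: dist_norm)
    finally show ?thesis .
  qed
  then show thesis by (rule that)
qed

text \<open>Differentiating the homogeneity relation in \<open>x\<close> brings out a factor
  \<open>t\<close> on the left by the chain rule, which lowers the degree by one.\<close>

lemma homog_pd:
  fixes g :: "real^'n \<Rightarrow> real"
  assumes h: "homog p a g" and d: "\<And>x. x \<noteq> a \<Longrightarrow> g differentiable (at x)"
  shows "homog (Suc p) a (pd i g)"
  unfolding homog_def
proof (intro allI impI)
  fix x :: "real^'n" and t :: real assume x: "x \<noteq> a" and t: "t > 0"
  let ?s = "\<lambda>x. a + t *\<^sub>R (x - a)"
  have s: "?s x \<noteq> a" using x t by simp
  have 1: "(?s has_derivative (\<lambda>v. t *\<^sub>R v)) (at x)"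
    by (auto intro!: derivative_eq_intros)
  have "(g has_derivative frechet_derivative g (at (?s x))) (at (?s x))"
    using d[OF s] frechet_derivative_works by blast
  from has_derivative_compose[OF 1 this]
  have L: "((\<lambda>x. g (?s x)) has_derivative (\<lambda>v. frechet_derivative g (at (?s x)) (t *\<^sub>R v))) (at x)" .
  have "(g has_derivative frechet_derivative g (at x)) (at x)"
    using d[OF x] frechet_derivative_works by blast
  then have "((\<lambda>x. g x / t ^ p) has_derivative (\<lambda>v. frechet_derivative g (at x) v / t ^ p)) (at x)"
    by (rule bounded_linear.has_derivative[OF bounded_linear_divide])
  then have R: "((\<lambda>x. g (?s x)) has_derivative (\<lambda>v. frechet_derivative g (at x) v / t ^ p)) (at x)"
    by (rule has_derivative_transform_within_open[of _ _ _ _ "- {a}"])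
       (use x t h in \<open>auto simp: homog_def\<close>)
  have "t * pd i g (?s x) = pd i g x / t ^ p"
    using fun_cong[OF has_derivative_unique[OF L R], of "axis i 1"]
    by (simp add: linear_cmul[OF linear_frechet_derivative[OF d[OF s]]])
  then show "pd i g (?s x) = pd i g x / t ^ Suc p"
    using t by (simp add: field_simps)
qed

text \<open>Leibniz rule with bookkeeping: a derivative falling on \<open>f\<close> lowers
  \<open>m\<close> by one, a derivative falling on \<open>g\<close> raises \<open>p\<close> by one.
  Both summands therefore have decay order \<open>m - p - 1\<close>, and
  \<open>p + k \<le> m\<close> survives because \<open>k\<close> drops as well.\<close>

lemma small_mult_homog:
  fixes f g :: "real^'n \<Rightarrow> real"
  assumes "open \<Omega>" "a \<in> \<Omega>" "small a \<Omega> k m f" "Ck_on k g (- {a})" "homog p a g" "p + k \<le> m"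
  shows "small a \<Omega> k (m - p) (\<lambda>x. f x * g x)"
  using assms(3-6)
proof (induction k arbitrary: f g m p)
  have lim: "((\<lambda>x. f x * g x / norm (x - a) ^ (m - p)) \<longlongrightarrow> 0) (at a)"
    if f: "((\<lambda>x. f x / norm (x - a) ^ m) \<longlongrightarrow> 0) (at a)" and g: "homog p a g" "continuous_on (- {a}) g"
      and "p \<le> m" for f g :: "real^'n \<Rightarrow> real" and m p
  proof -
    obtain C where C: "\<And>x. x \<noteq> a \<Longrightarrow> \<bar>g x\<bar> * norm (x - a) ^ p \<le> C"
      using homog_bounded[OF g] by blast
    have 1: "((\<lambda>x. C * \<bar>f x / norm (x - a) ^ m\<bar>) \<longlongrightarrow> 0) (at a)"
      using tendsto_mult_right_zero[OF tendsto_rabs_zero[OF f], of C] .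
    show ?thesis
    proof (rule Lim_null_comparison[OF _ 1])
      have "norm (f x * g x / norm (x - a) ^ (m - p)) \<le> C * \<bar>f x / norm (x - a) ^ m\<bar>" if x: "x \<noteq> a" for x
      proof -
        have "f x * g x / norm (x - a) ^ (m - p) = (f x / norm (x - a) ^ m) * (g x * norm (x - a) ^ p)"
          using \<open>p \<le> m\<close> x by (simp add: power_diff)
        then have "norm (f x * g x / norm (x - a) ^ (m - p)) = \<bar>f x / norm (x - a) ^ m\<bar> * (\<bar>g x\<bar> * norm (x - a) ^ p)"
          by (simp add: abs_mult)
        also have "\<dots> \<le> \<bar>f x / norm (x - a) ^ m\<bar> * C"
          by (intro mult_left_mono C x) auto
        finally show ?thesis by (simp add: mult.commute)
      qed
      then show "\<forall>\<^sub>F x in at a. norm (f x * g x / norm (x - a) ^ (m - p)) \<le> C * \<bar>f x / norm (x - a) ^ m\<bar>"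
        by (auto simp: eventually_at_filter)
    qed
  qed
  {
    case 0
    then have "continuous_on (\<Omega> - {a}) g" by (auto intro: continuous_on_subset)
    with 0 show ?case using lim[of f m p g] by (auto intro: continuous_on_mult)
  next
    case (Suc k)
    have fd: "(f has_derivative frechet_derivative f (at x)) (at x)" if "x \<in> \<Omega> - {a}" for x
      by (rule small_Suc_has_derivative[OF Suc.prems(1) that])
    have gd: "(g has_derivative frechet_derivative g (at x)) (at x)" if "x \<in> \<Omega> - {a}" for x
      using Ck_on_Suc_has_derivative[OF Suc.prems(2)] that by simp
    have "small a \<Omega> k (m - p - 1) (pd i (\<lambda>x. f x * g x))" for i
    proof (subst small_cong[OF assms(1,2)])
      have "small a \<Omega> k (m - Suc p) (\<lambda>x. f x * pd i g x)"
        by (rule Suc.IH[OF small_SucD[OF Suc.prems(1)] _ homog_pd[OF Suc.prems(3)]]) (use Suc.prems in auto)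
      moreover have "small a \<Omega> k (m - 1 - p) (\<lambda>x. pd i f x * g x)"
        by (rule Suc.IH[OF _ Ck_on_SucD[OF Suc.prems(2)] Suc.prems(3)]) (use Suc.prems in auto)
      ultimately show "small a \<Omega> k (m - p - 1) (\<lambda>x. f x * pd i g x + pd i f x * g x)"
        by (intro small_add assms(1,2)) (simp_all add: diff_commute)
      fix x assume x: "x \<in> \<Omega> - {a}"
      show "pd i (\<lambda>x. f x * g x) x = f x * pd i g x + pd i f x * g x"
        using frechet_derivative_at[OF has_derivative_mult[OF fd[OF x] gd[OF x]]] by metis
    qed
    moreover have "(\<lambda>x. f x * g x) differentiable (at x)" if "x \<in> \<Omega> - {a}" for x
      using has_derivative_mult[OF fd[OF that] gd[OF that]] by (auto simp: differentiable_def)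
    ultimately show ?case
      using lim[OF smallD[OF Suc.prems(1)] Suc.prems(3) Ck_on_imp_continuous_on[OF Suc.prems(2)]] Suc.prems(4)
      by simp
  }
qed

text \<open>The multiplier may be discontinuous at \<open>a\<close>; the decay of \<open>f\<close>
  absorbs the blow-up of its derivatives, and the product vanishes at \<open>a\<close> whatever
  \<open>g a\<close> is.\<close>

lemma Ck_on_flat_mult_homog:
  assumes "open \<Omega>" "a \<in> \<Omega>" "Ck_on k f \<Omega>" "flat k f a" "Ck_on k g (- {a})" "homog 0 a g"
  shows "Ck_on k (\<lambda>x. f x * g x) \<Omega>"
  using small_mult_homog[OF assms(1,2) flat_imp_small[OF assms(1-4)] assms(5,6)] flatD[OF assms(4)]
  by (intro Ck_on_small[OF assms(1,2), of k k]) auto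

lemma exists_sector_function:
  fixes a :: "real^'n"
  obtains g where "homog 0 a g" "Ck_on k g (- {a})"
    "\<And>x. norm (x - a) < 2 * (x - a) $ i \<Longrightarrow> g x = 1" "\<And>x. (x - a) $ i < 0 \<Longrightarrow> g x = 0"
proof
  \<comment> \<open>One minus twice the cosine of the angle between \<open>x - a\<close> and the
    axis: negative on the cone of half-angle 60 degrees, greater than 1 on the opposite half-space.
    The two truncations turn these ranges into the constants 1 and 0, and the exponent
    \<open>Suc k\<close> keeps them \<open>C^k\<close>.\<close>
  define q where "q x = 1 - 2 * ((x - a) $ i * inverse (norm (x - a)))" for x
  let ?g = "\<lambda>x. max 0 (1 - max 0 (q x) ^ Suc k) ^ Suc k"
  have o: "open (- {a})" by auto
  have "Ck_on k q (- {a})"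
    unfolding q_def
    by (intro Ck_on_diff Ck_on_const Ck_on_cmult Ck_on_mult Ck_on_coord_diff Ck_on_inverse Ck_on_norm_diff o) auto
  then show "Ck_on k ?g (- {a})"
    by (intro Ck_on_pos_power Ck_on_diff Ck_on_const o) auto
  have "q (a + t *\<^sub>R (x - a)) = q x" if "t > 0" for t x
    using that by (simp add: q_def)
  then show "homog 0 a ?g" by (simp add: homog_def)
  show "?g x = 1" if "norm (x - a) < 2 * (x - a) $ i" for x
  proof -
    have "x \<noteq> a" using that by auto
    then have "q x \<le> 0" using that by (simp add: q_def field_simps)
    then show ?thesis by (simp add: max_absorb1)
  qed
  show "?g x = 0" if "(x - a) $ i < 0" for x
  proof -
    have "x \<noteq> a" using that by auto
    then have "q x \<ge> 1" using that by (simp add: q_def field_simps)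
    then have "max 0 (q x) ^ Suc k \<ge> 1" using one_le_power[of "max 0 (q x)" "Suc k"] by simp
    then show ?thesis by (simp add: max_absorb1)
  qed
qed

subsection \<open>Rapidly convergent series of compactly supported functions\<close>

text \<open>The thresholds are fixed before the coefficients, because the coefficients will later be
  chosen in terms of \<open>T\<close>. Compact support bounds each function and its partials. The
  geometric bound is part of the claim since the induction applies it to the partials, where the
  Weierstrass test makes the differentiated series converge uniformly and permits termwise
  differentiation.\<close>

lemma Ck_on_series:
  fixes g :: "nat \<Rightarrow> real^'n \<Rightarrow> real"
  assumes "compact K" "\<And>n. Ck_on k (g n) UNIV" "\<And>n x. x \<notin> K \<Longrightarrow> g n x = 0"
  shows "\<exists>\<epsilon>. (\<forall>n. \<epsilon> n > 0) \<and> (\<forall>\<alpha>. (\<forall>n. \<bar>\<alpha> n\<bar> \<le> \<epsilon> n) \<longrightarrow>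
    (\<forall>n x. \<bar>\<alpha> n * g n x\<bar> \<le> (1/2) ^ n) \<and> Ck_on k (\<lambda>x. \<Sum>n. \<alpha> n * g n x) UNIV)"
  using assms(2,3)
proof (induction k arbitrary: g)
  case 0
  have "\<exists>M. M > 0 \<and> (\<forall>x. \<bar>g n x\<bar> \<le> M)" for n
  proof -
    have "compact (g n ` K)"
      using 0(1)[of n] by (intro compact_continuous_image[OF _ assms(1)]) (auto intro: continuous_on_subset)
    then obtain M where M: "\<And>x. x \<in> K \<Longrightarrow> \<bar>g n x\<bar> \<le> M"
      using compact_imp_bounded bounded_real by (metis image_eqI)
    have "\<bar>g n x\<bar> \<le> max M 1" for x using M[of x] 0(2)[of x n] by (cases "x \<in> K") auto
    then show ?thesis by (intro exI[of _ "max M 1"]) auto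
  qed
  then obtain M where M: "\<And>n. M n > 0" "\<And>n x. \<bar>g n x\<bar> \<le> M n" by metis
  have bd: "\<bar>\<alpha> n * g n x\<bar> \<le> (1/2) ^ n" if "\<forall>n. \<bar>\<alpha> n\<bar> \<le> (1/2) ^ n / M n" for \<alpha> n x
  proof -
    have "\<bar>\<alpha> n * g n x\<bar> \<le> (1/2) ^ n / M n * M n"
      unfolding abs_mult using that M less_imp_le[OF M(1)] by (intro mult_mono) auto
    then show ?thesis using M(1)[of n] by simp
  qed
  have "continuous_on UNIV (\<lambda>x. \<Sum>n. \<alpha> n * g n x)" if "\<forall>n. \<bar>\<alpha> n\<bar> \<le> (1/2) ^ n / M n" for \<alpha>
  proof (rule uniform_limit_theorem)
    show "uniform_limit UNIV (\<lambda>n x. \<Sum>i<n. \<alpha> i * g i x) (\<lambda>x. \<Sum>n. \<alpha> n * g n x) sequentially"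
      by (rule Weierstrass_m_test[of _ _ "\<lambda>n. (1/2) ^ n"]) (use bd[OF that] in \<open>auto simp: summable_geometric\<close>)
    show "\<forall>\<^sub>F n in sequentially. continuous_on UNIV (\<lambda>x. \<Sum>i<n. \<alpha> i * g i x)"
      using 0(1) by (auto intro!: always_eventually continuous_intros)
  qed simp
  then show ?case using bd M(1) by (intro exI[of _ "\<lambda>n. (1/2) ^ n / M n"]) auto
next
  case (Suc k)
  define good where "good h \<epsilon> \<longleftrightarrow> (\<forall>n. \<epsilon> n > 0) \<and> (\<forall>\<alpha>. (\<forall>n. \<bar>\<alpha> n\<bar> \<le> \<epsilon> n) \<longrightarrow>
    (\<forall>n x. \<bar>\<alpha> n * h n x\<bar> \<le> (1/2) ^ n) \<and> Ck_on k (\<lambda>x. \<Sum>n. \<alpha> n * h n x) UNIV)"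
    for h :: "nat \<Rightarrow> real^'n \<Rightarrow> real" and \<epsilon> :: "nat \<Rightarrow> real"
  have "\<exists>\<epsilon>. good (\<lambda>n. pd i (g n)) \<epsilon>" for i
    unfolding good_def
  proof (rule Suc.IH)
    show "Ck_on k (pd i (g n)) UNIV" for n using Suc.prems(1) by simp
    show "pd i (g n) x = 0" if "x \<notin> K" for n x
    proof -
      have "open (- K)" using assms(1) compact_imp_closed by blast
      then have "frechet_derivative (g n) (at x) = frechet_derivative (\<lambda>x. 0) (at x)"
        by (rule frechet_derivative_cong_open) (use that Suc.prems(2) in auto)
      then show ?thesis by simp
    qed
  qed
  then obtain e where e': "\<And>i. good (\<lambda>n. pd i (g n)) (e i)" by metis
  have e: "\<And>i n. e i n > 0"
    and e1: "\<And>i \<alpha> n x. (\<forall>n. \<bar>\<alpha> n\<bar> \<le> e i n) \<Longrightarrow> \<bar>\<alpha> n * pd i (g n) x\<bar> \<le> (1/2) ^ n"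
    and e2: "\<And>i \<alpha>. (\<forall>n. \<bar>\<alpha> n\<bar> \<le> e i n) \<Longrightarrow> Ck_on k (\<lambda>x. \<Sum>n. \<alpha> n * pd i (g n) x) UNIV"
    using e' unfolding good_def by simp_all
  have "\<exists>\<epsilon>. good g \<epsilon>"
    unfolding good_def by (rule Suc.IH) (use Suc.prems in \<open>auto simp del: Ck_on.simps intro: Ck_on_SucD\<close>)
  then obtain e0 where "good g e0" ..
  then have e0: "\<And>n. e0 n > 0"
    and e01: "\<And>\<alpha> n x. (\<forall>n. \<bar>\<alpha> n\<bar> \<le> e0 n) \<Longrightarrow> \<bar>\<alpha> n * g n x\<bar> \<le> (1/2) ^ n"
    unfolding good_def by simp_all
  \<comment> \<open>One threshold for \<open>g\<close> itself and one for each of the finitely many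
    coordinate directions, so the minimum stays positive.\<close>
  define E where "E n = min (e0 n) (Min (range (\<lambda>i. e i n)))" for n
  have E: "E n > 0" "E n \<le> e0 n" "E n \<le> e i n" for n i
    using e0 e by (auto simp: E_def min.coboundedI2)
  have "(\<forall>n x. \<bar>\<alpha> n * g n x\<bar> \<le> (1/2) ^ n) \<and> Ck_on (Suc k) (\<lambda>x. \<Sum>n. \<alpha> n * g n x) UNIV"
    if \<alpha>: "\<forall>n. \<bar>\<alpha> n\<bar> \<le> E n" for \<alpha>
  proof -
    have b0: "\<bar>\<alpha> n * g n x\<bar> \<le> (1/2) ^ n" for n x
      by (rule e01) (use \<alpha> E(2) in \<open>meson order_trans\<close>)
    have le: "\<forall>n. \<bar>\<alpha> n\<bar> \<le> e i n" for i
      using \<alpha> E(3) by (meson order_trans)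
    note b = e1[OF le] and C = e2[OF le]
    let ?D = "\<lambda>i x. \<Sum>n. \<alpha> n * pd i (g n) x"
    have gd: "g n differentiable (at x)" for n x using Suc.prems(1)[of n] by simp
    have sm: "summable (\<lambda>n. \<alpha> n * g n x)" for x
      by (rule summable_comparison_test'[of "\<lambda>n. (1/2) ^ n"]) (use b0 in \<open>auto simp: summable_geometric\<close>)
    have "\<exists>G. \<forall>x\<in>UNIV. (\<lambda>n. \<alpha> n * g n x) sums (G x) \<and>
      (G has_derivative (\<lambda>v. \<Sum>i\<in>UNIV. v $ i * ?D i x)) (at x within UNIV)"
    proof (rule has_derivative_series)
      show "((\<lambda>x. \<alpha> n * g n x) has_derivative (\<lambda>v. \<Sum>i\<in>UNIV. v $ i * (\<alpha> n * pd i (g n) x))) (at x within UNIV)" for n x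
      proof -
        have "(g n has_derivative (\<lambda>v. \<Sum>i\<in>UNIV. v $ i * pd i (g n) x)) (at x)"
          using frechet_derivative_works[of "g n" "at x"] gd
          by (simp flip: frechet_derivative_axis_sum)
        from has_derivative_mult_right[OF this, of "\<alpha> n"] show ?thesis
          by (simp add: sum_distrib_left mult.left_commute)
      qed
      show "\<forall>\<^sub>F n in sequentially. \<forall>x\<in>UNIV. \<forall>h.
          norm ((\<Sum>m<n. \<Sum>i\<in>UNIV. h $ i * (\<alpha> m * pd i (g m) x)) - (\<Sum>i\<in>UNIV. h $ i * ?D i x)) \<le> c * norm h"
        if c: "c > 0" for c
      proof -
        have u: "uniform_limit UNIV (\<lambda>n x. \<Sum>m<n. \<alpha> m * pd i (g m) x) (?D i) sequentially" for i
          by (rule Weierstrass_m_test[of _ _ "\<lambda>n. (1/2) ^ n"]) (use b in \<open>auto simp: summable_geometric\<close>)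
        have "c / real CARD('n) > 0" using c by simp
        then have "\<forall>\<^sub>F n in sequentially. \<forall>i\<in>UNIV. \<forall>x\<in>UNIV.
            dist (\<Sum>m<n. \<alpha> m * pd i (g m) x) (?D i x) < c / real CARD('n)"
          using u unfolding uniform_limit_iff by (intro eventually_ball_finite) auto
        then show ?thesis
        proof (rule eventually_mono, intro ballI allI)
          fix n x and h :: "real^'n"
          assume *: "\<forall>i\<in>UNIV. \<forall>x\<in>UNIV. dist (\<Sum>m<n. \<alpha> m * pd i (g m) x) (?D i x) < c / real CARD('n)"
          have "(\<Sum>m<n. \<Sum>i\<in>UNIV. h $ i * (\<alpha> m * pd i (g m) x)) - (\<Sum>i\<in>UNIV. h $ i * ?D i x)
             = (\<Sum>i\<in>UNIV. h $ i * ((\<Sum>m<n. \<alpha> m * pd i (g m) x) - ?D i x))"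
            by (subst sum.swap) (simp add: sum_distrib_left sum_subtractf right_diff_distrib)
          also have "norm \<dots> \<le> (\<Sum>i\<in>(UNIV::'n set). norm h * (c / real CARD('n)))"
          proof (rule sum_norm_le)
            fix i
            have "\<bar>(\<Sum>m<n. \<alpha> m * pd i (g m) x) - ?D i x\<bar> \<le> c / real CARD('n)"
              using * by (auto simp: dist_real_def intro: less_imp_le)
            then show "norm (h $ i * ((\<Sum>m<n. \<alpha> m * pd i (g m) x) - ?D i x)) \<le> norm h * (c / real CARD('n))"
              unfolding real_norm_def abs_mult by (intro mult_mono component_le_norm_cart) auto
          qed
          also have "\<dots> = c * norm h" by simp
          finally show "norm ((\<Sum>m<n. \<Sum>i\<in>UNIV. h $ i * (\<alpha> m * pd i (g m) x)) - (\<Sum>i\<in>UNIV. h $ i * ?D i x)) \<le> c * norm h" .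
        qed
      qed
      show "(\<lambda>n. \<alpha> n * g n 0) sums (\<Sum>n. \<alpha> n * g n 0)" using sm by (simp add: summable_sums)
    qed auto
    then obtain G where G: "\<And>x. (\<lambda>n. \<alpha> n * g n x) sums (G x)"
      "\<And>x. (G has_derivative (\<lambda>v. \<Sum>i\<in>UNIV. v $ i * ?D i x)) (at x)" by auto
    have "G = (\<lambda>x. \<Sum>n. \<alpha> n * g n x)" using G(1) sums_unique by blast
    moreover have "Ck_on (Suc k) G UNIV"
      by (rule Ck_on_SucI[OF open_UNIV G(2)]) (intro Ck_on_sum Ck_on_cmult C open_UNIV)
    ultimately show ?thesis using b0 by blast
  qed
  then show ?case using E(1) by (intro exI[of _ E]) blast
qed

subsection \<open>Taylor polynomials\<close>

text \<open>Homogeneous part of degree \<open>j\<close> of the Taylor expansion at \<open>a\<close>, by Euler's identity for homogeneous functions.\<close>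

primrec hterm :: "real^'n \<Rightarrow> nat \<Rightarrow> (real^'n \<Rightarrow> real) \<Rightarrow> real^'n \<Rightarrow> real" where
  "hterm a 0 f x = f a"
| "hterm a (Suc j) f x = (\<Sum>i\<in>UNIV. (x - a) $ i * hterm a j (pd i f) x) / real (Suc j)"

lemma Ck_on_hterm: "open \<Omega> \<Longrightarrow> Ck_on k (hterm a j f) \<Omega>"
proof (induction j arbitrary: f)
  case 0
  have "hterm a 0 f = (\<lambda>x. f a)" by auto
  then show ?case using 0 by (simp only: Ck_on_const)
next
  case (Suc j)
  have *: "hterm a (Suc j) f = (\<lambda>x. (1 / real (Suc j)) * (\<Sum>i\<in>UNIV. (x - a) $ i * hterm a j (pd i f) x))"
    by (simp add: fun_eq_iff)
  show ?case unfolding *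
    by (intro Ck_on_cmult Ck_on_sum Ck_on_mult Ck_on_coord_diff Suc)
qed

lemma hterm_cong:
  assumes "open \<Omega>" "a \<in> \<Omega>" "\<And>x. x \<in> \<Omega> \<Longrightarrow> f x = g x"
  shows "hterm a j f = hterm a j g"
  using assms(3)
proof (induction j arbitrary: f g)
  case 0
  then show ?case using assms(2) by (simp add: fun_eq_iff)
next
  case (Suc j)
  have "hterm a j (pd i f) = hterm a j (pd i g)" for i
    by (rule Suc.IH) (simp add: frechet_derivative_cong_open[OF assms(1) _ Suc.prems])
  then show ?case by (simp add: fun_eq_iff)
qed

lemma hterm_Suc_at [simp]: "hterm a (Suc j) f a = 0"
  by simp

lemma has_derivative_coord_diff: "((\<lambda>x. (x - a) $ i) has_derivative (\<lambda>v. v $ i)) (at x)"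
proof -
  have "((\<lambda>x. x - a) has_derivative (\<lambda>v. v)) (at x)"
    by (auto intro!: derivative_eq_intros)
  from bounded_linear.has_derivative[OF bounded_linear_vec_nth this] show ?thesis .
qed

text \<open>Differentiation sends the degree \<open>j + 1\<close> term of \<open>f\<close> to the
  degree \<open>j\<close> term of the partial. The product rule gives this once directly; by
  symmetry of second partials the remaining double sum is the Euler sum of \<open>pd l f\<close> and
  gives it \<open>j\<close> more times, so the total cancels the normalising factor
  \<open>Suc j\<close>.\<close>

lemma has_derivative_hterm:
  assumes "open \<Omega>" "a \<in> \<Omega>" "Ck_on (Suc j) f \<Omega>"
  shows "(hterm a (Suc j) f has_derivative (\<lambda>v. \<Sum>l\<in>UNIV. v $ l * hterm a j (pd l f) x)) (at x)"
  using assms(3)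
proof (induction j arbitrary: f)
  case 0
  have *: "hterm a (Suc 0) f = (\<lambda>x. \<Sum>i\<in>UNIV. (x - a) $ i * pd i f a)"
    by (simp add: fun_eq_iff)
  show ?case unfolding * hterm.simps(1)
    by (intro has_derivative_sum has_derivative_mult_left has_derivative_coord_diff)
next
  case (Suc j)
  let ?H = "\<lambda>j f. hterm a j f x"
  have C: "Ck_on (Suc j) (pd i f) \<Omega>" for i
    using Suc.prems by (simp only: Ck_on.simps(2)[of "Suc j"])
  have C2: "Ck_on 2 f \<Omega>"
    by (rule Ck_on_mono[OF Suc.prems]) simp
  have *: "hterm a (Suc (Suc j)) f = (\<lambda>x. (\<Sum>i\<in>UNIV. (x - a) $ i * hterm a (Suc j) (pd i f) x) / real (Suc (Suc j)))"
    by (intro ext) (rule hterm.simps(2))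
  have D: "(hterm a (Suc (Suc j)) f has_derivative
      (\<lambda>v. (\<Sum>i\<in>UNIV. (x - a) $ i * (\<Sum>l\<in>UNIV. v $ l * ?H j (pd l (pd i f))) + v $ i * ?H (Suc j) (pd i f))
        / real (Suc (Suc j)))) (at x)"
    unfolding *
    by (intro bounded_linear.has_derivative[OF bounded_linear_divide] has_derivative_sum
        has_derivative_mult[OF has_derivative_coord_diff Suc.IH[OF C]])
  have sym: "hterm a j (pd l (pd i f)) = hterm a j (pd i (pd l f))" for i l
    by (rule hterm_cong[OF assms(1,2)]) (rule pd_commute[OF assms(1) _ C2])
  have "(\<Sum>i\<in>UNIV. (x - a) $ i * (\<Sum>l\<in>UNIV. v $ l * ?H j (pd l (pd i f))) + v $ i * ?H (Suc j) (pd i f))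
      / real (Suc (Suc j)) = (\<Sum>l\<in>UNIV. v $ l * ?H (Suc j) (pd l f))" for v
  proof -
    have "(\<Sum>i\<in>UNIV. (x - a) $ i * (\<Sum>l\<in>UNIV. v $ l * ?H j (pd l (pd i f))))
        = (\<Sum>l\<in>UNIV. v $ l * (\<Sum>i\<in>UNIV. (x - a) $ i * ?H j (pd i (pd l f))))"
      unfolding sum_distrib_left
      by (subst sum.swap, intro sum.cong refl, subst sym) (rule mult.left_commute)
    also have "\<dots> = (\<Sum>l\<in>UNIV. real (Suc j) * (v $ l * ?H (Suc j) (pd l f)))"
      by (intro sum.cong refl) simp
    finally have eq: "(\<Sum>i\<in>UNIV. (x - a) $ i * (\<Sum>l\<in>UNIV. v $ l * ?H j (pd l (pd i f))))
        = real (Suc j) * (\<Sum>l\<in>UNIV. v $ l * ?H (Suc j) (pd l f))"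
      by (simp only: sum_distrib_left)
    show ?thesis
      unfolding sum.distrib eq by (simp add: field_simps del: hterm.simps)
  qed
  then show ?case using D by (simp del: hterm.simps)
qed

text \<open>A partial derivative of the remainder is the remainder, one order lower, of the partial
  derivative, which matches the recursion of \<open>flat\<close>.\<close>

lemma flat_taylor:
  assumes "open \<Omega>" "a \<in> \<Omega>" "Ck_on k f \<Omega>"
  shows "flat k (\<lambda>x. f x - (\<Sum>j\<le>k. hterm a j f x)) a"
  using assms(3)
proof (induction k arbitrary: f)
  case 0
  then show ?case by simp
next
  case (Suc k)
  let ?R = "\<lambda>x. f x - (\<Sum>j\<le>Suc k. hterm a j f x)"
  have "flat k (pd i ?R) a" for i
  proof (subst flat_cong[OF assms(1,2)])
    show "flat k (\<lambda>x. pd i f x - (\<Sum>j\<le>k. hterm a j (pd i f) x)) a"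
      using Suc by simp
    fix x assume x: "x \<in> \<Omega>"
    have R: "?R = (\<lambda>x. f x - (f a + (\<Sum>j\<le>k. hterm a (Suc j) f x)))"
      by (simp add: sum.atMost_Suc_shift del: sum.atMost_Suc hterm.simps(2))
    have C: "Ck_on (Suc j) f \<Omega>" if "j \<le> k" for j
      by (rule Ck_on_mono[OF Suc.prems]) (use that in simp)
    have "(?R has_derivative (\<lambda>v. frechet_derivative f (at x) v -
        (0 + (\<Sum>j\<le>k. \<Sum>l\<in>UNIV. v $ l * hterm a j (pd l f) x)))) (at x)"
      unfolding R
      by (intro has_derivative_diff has_derivative_add has_derivative_const has_derivative_sum
          has_derivative_hterm[OF assms(1,2)] C Ck_on_Suc_has_derivative[OF Suc.prems x]) simp
    from frechet_derivative_at[OF this, symmetric]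
    have "pd i ?R x = pd i f x - (\<Sum>j\<le>k. \<Sum>l\<in>UNIV. axis i 1 $ l * hterm a j (pd l f) x)"
      by simp
    moreover have "(\<Sum>l\<in>UNIV. axis i 1 $ l * hterm a j (pd l f) x) = hterm a j (pd i f) x" for j
    proof -
      have "(\<Sum>l\<in>UNIV. axis i 1 $ l * hterm a j (pd l f) x) = (\<Sum>l\<in>UNIV. if l = i then hterm a j (pd l f) x else 0)"
        by (intro sum.cong) (auto simp: axis_def)
      then show ?thesis by simp
    qed
    ultimately show "pd i ?R x = pd i f x - (\<Sum>j\<le>k. hterm a j (pd i f) x)" by simp
  qed
  moreover have "?R a = 0"
    by (simp add: sum.atMost_Suc_shift del: sum.atMost_Suc hterm.simps(2))
  ultimately show ?case by simp
qed

subsection \<open>Second-order Leibniz operators\<close>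

text \<open>Since \<open>d\<close> kills the integers, the fractional part of \<open>N * c\<close>
  has image \<open>N * d c\<close> although it stays in \<open>[0, 1)\<close>. Division by a fixed
  integer brings the argument below \<open>e\<close>, and \<open>N\<close> is taken large enough to
  compensate for it in the image.\<close>

lemma additive_unbounded_near_0:
  fixes d :: "real \<Rightarrow> real"
  assumes add: "\<And>x y. d (x + y) = d x + d y" and one: "d 1 = 0" and c: "d c \<noteq> 0" and e: "e > 0"
  obtains b where "\<bar>b\<bar> \<le> e" "\<bar>d b\<bar> \<ge> K"
proof -
  have zero: "d 0 = 0" using add[of 0 0] by simp
  have neg: "d (- x) = - d x" for x using add[of x "-x"] zero by simp
  have nat: "d (real n * x) = real n * d x" for n x
    by (induction n) (simp_all add: zero add algebra_simps)
  have int: "d (real_of_int z) = 0" for z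
  proof (cases z)
    case (nonneg n)
    then show ?thesis using nat[of n 1] one by simp
  next
    case (neg n)
    then show ?thesis using nat[of "Suc n" 1] one \<open>\<And>x. d (- x) = - d x\<close>[of "real (Suc n)"] by simp
  qed
  obtain M0 :: nat where "1 / e < real M0" using reals_Archimedean2 by blast
  then have M: "1 / real (Suc M0) \<le> e" using e by (simp add: field_simps)
  obtain N :: nat where "real (Suc M0) * K / \<bar>d c\<bar> < real N" using reals_Archimedean2 by blast
  then have N: "real (Suc M0) * K \<le> real N * \<bar>d c\<bar>" using c by (simp add: field_simps)
  define b where "b = frac (real N * c) / real (Suc M0)"
  have "real (Suc M0) * d b = d (frac (real N * c))"
    using nat[of "Suc M0" b] by (simp add: b_def del: of_nat_Suc)
  also have "\<dots> = real N * d c"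
    using add[of "frac (real N * c)" "real_of_int \<lfloor>real N * c\<rfloor>"] int nat by (simp add: frac_def)
  finally have db: "real (Suc M0) * d b = real N * d c" .
  have "real (Suc M0) * \<bar>d b\<bar> = real N * \<bar>d c\<bar>"
    using arg_cong[OF db, of abs] by (simp add: abs_mult)
  then have "real (Suc M0) * K \<le> real (Suc M0) * \<bar>d b\<bar>" using N by simp
  then have "K \<le> \<bar>d b\<bar>" by (simp only: mult_le_cancel_left_pos of_nat_0_less_iff zero_less_Suc)
  moreover have "\<bar>b\<bar> \<le> e"
  proof -
    have "\<bar>b\<bar> \<le> 1 / real (Suc M0)"
      unfolding b_def abs_divide using frac_ge_0[of "real N * c"] frac_lt_1[of "real N * c"]
      by (intro frac_le) auto
    then show ?thesis using M by linarith
  qed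
  ultimately show thesis by (rule that[rotated])
qed

section \<open>Bump functions, locality, flat functions and constants\<close>

definition bump :: "nat \<Rightarrow> real \<Rightarrow> real^'n \<Rightarrow> real^'n \<Rightarrow> real" where
  "bump k r y x = max 0 (r\<^sup>2 - (norm (x - y))\<^sup>2) ^ Suc k"

lemma Ck_on_bump: "open \<Omega> \<Longrightarrow> Ck_on k (bump k r y) \<Omega>"
  unfolding bump_def[abs_def]
  by (intro Ck_on_pos_power Ck_on_diff Ck_on_const Ck_on_norm_power2_diff) auto

lemma bump_center: "r > 0 \<Longrightarrow> bump k r y y > 0"
  by (simp add: bump_def)

lemma bump_eq_0: "r > 0 \<Longrightarrow> r \<le> dist x y \<Longrightarrow> bump k r y x = 0"
  by (simp add: bump_def dist_norm max_absorb1 power_mono)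

text \<open>The axioms are chosen to hold for \<open>(T, A)\<close> and for \<open>(A, 0)\<close>,
  so each consequence is proved once for both operators. The operators act on total functions and
  see only the values on \<open>\<Omega>\<close>.\<close>

locale leibniz_pair =
  fixes \<Omega> :: "(real^'n) set" and k :: nat and T A :: "(real^'n \<Rightarrow> real) \<Rightarrow> real^'n \<Rightarrow> real"
  assumes open_domain: "open \<Omega>"
    and T_cont: "Ck_on k f \<Omega> \<Longrightarrow> continuous_on \<Omega> (T f)"
    and T_cong: "(\<And>y. y \<in> \<Omega> \<Longrightarrow> f y = g y) \<Longrightarrow> x \<in> \<Omega> \<Longrightarrow> T f x = T g x"
    and A_cong: "(\<And>y. y \<in> \<Omega> \<Longrightarrow> f y = g y) \<Longrightarrow> x \<in> \<Omega> \<Longrightarrow> A f x = A g x"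
    and T_add: "Ck_on k f \<Omega> \<Longrightarrow> Ck_on k g \<Omega> \<Longrightarrow> x \<in> \<Omega> \<Longrightarrow> T (\<lambda>y. f y + g y) x = T f x + T g x"
    and T_mult: "Ck_on k f \<Omega> \<Longrightarrow> Ck_on k g \<Omega> \<Longrightarrow> x \<in> \<Omega> \<Longrightarrow>
      T (\<lambda>y. f y * g y) x = f x * T g x + g x * T f x + 2 * A f x * A g x"
    and A_mult: "Ck_on k f \<Omega> \<Longrightarrow> Ck_on k g \<Omega> \<Longrightarrow> x \<in> \<Omega> \<Longrightarrow>
      A (\<lambda>y. f y * g y) x = f x * A g x + g x * A f x"
begin

lemma T_zero: "x \<in> \<Omega> \<Longrightarrow> T (\<lambda>y. 0) x = 0"
  using T_add[of "\<lambda>y. 0" "\<lambda>y. 0" x] open_domain by simp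

lemma A_zero: "x \<in> \<Omega> \<Longrightarrow> A (\<lambda>y. 0) x = 0"
  using A_mult[of "\<lambda>y. 0" "\<lambda>y. 0" x] open_domain by simp

lemma T_diff:
  assumes "Ck_on k f \<Omega>" "Ck_on k g \<Omega>" "x \<in> \<Omega>"
  shows "T (\<lambda>y. f y - g y) x = T f x - T g x"
  using T_add[OF Ck_on_diff[OF open_domain assms(1,2)] assms(2,3)] by simp

text \<open>Here \<open>f\<close> vanishes at \<open>x\<close>, so the rule for \<open>A\<close> on
  the zero product gives \<open>A f x = 0\<close>. This removes the cross term from the rule for
  \<open>T\<close>, which leaves \<open>p x * T f x = 0\<close>.\<close>

lemma T_eq_0_if_annihilated:
  assumes "Ck_on k f \<Omega>" "Ck_on k p \<Omega>" "x \<in> \<Omega>" "\<And>y. y \<in> \<Omega> \<Longrightarrow> f y * p y = 0" "p x \<noteq> 0"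
  shows "T f x = 0"
proof -
  have fx: "f x = 0" using assms by fastforce
  have "A (\<lambda>y. f y * p y) x = 0" "T (\<lambda>y. f y * p y) x = 0"
    using A_cong[of "\<lambda>y. f y * p y" "\<lambda>y. 0"] T_cong[of "\<lambda>y. f y * p y" "\<lambda>y. 0"] A_zero T_zero assms by auto
  then show ?thesis
    using A_mult[OF assms(1-3)] T_mult[OF assms(1-3)] fx assms(5) by simp
qed

lemma T_local:
  assumes "Ck_on k f \<Omega>" "Ck_on k g \<Omega>" "x \<in> \<Omega>" "open U" "x \<in> U" "\<And>y. y \<in> U \<Longrightarrow> f y = g y"
  shows "T f x = T g x"
proof -
  obtain r where r: "r > 0" "ball x r \<subseteq> U" using assms openE by blast
  have "T (\<lambda>y. f y - g y) x = 0"
  proof (rule T_eq_0_if_annihilated[where p = "bump k r x"])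
    show "(f y - g y) * bump k r x y = 0" for y
    proof (cases "y \<in> ball x r")
      case True
      then show ?thesis using r assms(6) by auto
    next
      case False
      then show ?thesis using bump_eq_0[OF r(1), of y x] by (simp add: dist_commute)
    qed
    show "bump k r x x \<noteq> 0" using bump_center[OF r(1), of k x] by simp
  qed (use assms open_domain in \<open>auto intro: Ck_on_diff Ck_on_bump\<close>)
  then show ?thesis using T_diff[OF assms(1-3)] by simp
qed

lemma T_flat:
  assumes "Ck_on k f \<Omega>" "a \<in> \<Omega>" "flat k f a"
  shows "T f a = 0"
proof -
  fix i :: 'n
  obtain g where g: "homog 0 a g" "Ck_on k g (- {a})"
    "\<And>x. norm (x - a) < 2 * (x - a) $ i \<Longrightarrow> g x = 1" "\<And>x. (x - a) $ i < 0 \<Longrightarrow> g x = 0"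
    using exists_sector_function[of a k i] by blast
  \<comment> \<open>For \<open>t < 0\<close> the axis runs in the half-space and for
    \<open>t > 0\<close> in the cone; both are open, so locality applies at each such point of
    \<open>\<Omega>\<close>.\<close>
  let ?h = "\<lambda>x. f x * g x" and ?p = "\<lambda>t. a + t *\<^sub>R axis i 1"
  have h: "Ck_on k ?h \<Omega>"
    by (rule Ck_on_flat_mult_homog[OF open_domain assms(2,1,3) g(2,1)])
  have p: "(?p \<longlongrightarrow> a) (at 0)"
    by (auto intro!: tendsto_eq_intros)
  have Tp: "((\<lambda>t. T u (?p t)) \<longlongrightarrow> T u a) (at 0)" if "Ck_on k u \<Omega>" for u
  proof -
    have "isCont (T u) a"
      using T_cont[OF that] assms(2) open_domain by (simp add: continuous_on_eq_continuous_at)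
    then show ?thesis using isCont_tendsto_compose[OF _ p] by blast
  qed
  have "eventually (\<lambda>t. ?p t \<in> \<Omega>) (at 0)"
    using topological_tendstoD[OF p open_domain assms(2)] .
  then have evl: "eventually (\<lambda>t. ?p t \<in> \<Omega>) (at_left 0)" and evr: "eventually (\<lambda>t. ?p t \<in> \<Omega>) (at_right 0)"
    by (auto simp: eventually_at_split)
  have "eventually (\<lambda>t. T ?h (?p t) = 0) (at_left 0)"
    using evl eventually_at_left_real[of "-1" 0, simplified]
  proof eventually_elim
    case (elim t)
    have "T ?h (?p t) = T (\<lambda>x. 0) (?p t)"
    proof (rule T_local[OF h _ elim(1)])
      show "open {x. (x - a) $ i < 0}"
        by (intro open_Collect_less continuous_intros)
    qed (use elim g(4) open_domain in auto)
    then show ?case using T_zero elim(1) by simp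
  qed
  then have "((\<lambda>t. T ?h (?p t)) \<longlongrightarrow> 0) (at_left 0)"
    by (rule tendsto_eventually)
  then have h0: "T ?h a = 0"
    using tendsto_unique[OF trivial_limit_at_left_real tendsto_mono[OF at_le Tp[OF h]]] by auto
  have "eventually (\<lambda>t. T ?h (?p t) = T f (?p t)) (at_right 0)"
    using evr eventually_at_right_real[of 0 1, simplified]
  proof eventually_elim
    case (elim t)
    show ?case
    proof (rule T_local[OF h assms(1) elim(1)])
      show "open {x. norm (x - a) < 2 * (x - a) $ i}"
        by (intro open_Collect_less continuous_intros)
    qed (use elim g(3) in \<open>auto simp: norm_axis_1\<close>)
  qed
  then have "((\<lambda>t. T ?h (?p t)) \<longlongrightarrow> T f a) (at_right 0)"
    using tendsto_mono[OF at_le Tp[OF assms(1)]] by (subst tendsto_cong) auto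
  then have "T ?h a = T f a"
    using tendsto_unique[OF trivial_limit_at_right_real tendsto_mono[OF at_le Tp[OF h]]] by auto
  then show ?thesis using h0 by simp
qed

text \<open>Gliding hump: if a constant \<open>c\<close> had \<open>T c \<noteq> 0\<close> near \<open>a\<close>, then arbitrarily small
  constants would have arbitrarily large images, and planting such constants on disjoint
  bumps accumulating at \<open>a\<close> would give a function whose image is unbounded at \<open>a\<close>.\<close>

lemma T_const:
  assumes A0: "\<And>c x. x \<in> \<Omega> \<Longrightarrow> A (\<lambda>y. c) x = 0" and a: "a \<in> \<Omega>"
  shows "T (\<lambda>y. c) a = 0"
proof (rule ccontr)
  assume ne: "T (\<lambda>y. c) a \<noteq> 0"
  have C: "Ck_on k (\<lambda>y. b) \<Omega>" for b using open_domain by simp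
  have "isCont (T (\<lambda>y. c)) a"
    using T_cont[OF C] a open_domain by (simp add: continuous_on_eq_continuous_at)
  then obtain d1 where d1: "d1 > 0" "\<And>x. dist x a < d1 \<Longrightarrow> dist (T (\<lambda>y. c) x) (T (\<lambda>y. c) a) < \<bar>T (\<lambda>y. c) a\<bar>"
    unfolding continuous_at_eps_delta using ne by (metis zero_less_abs_iff)
  obtain d2 where d2: "d2 > 0" "ball a d2 \<subseteq> \<Omega>" using open_domain a openE by blast
  define d where "d = min d1 d2"
  have d: "d > 0" using d1 d2 by (simp add: d_def)
  have dx: "x \<in> \<Omega> \<and> T (\<lambda>y. c) x \<noteq> 0" if "dist x a < d" for x
    using d1(1) d1(2)[of x] d2 that by (auto simp: d_def dist_real_def dist_commute)
  define \<delta> where "\<delta> = d / 2"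
  have \<delta>: "\<delta> > 0" using d by (simp add: \<delta>_def)
  fix i :: 'n
  define x where "x n = a + (\<delta> / 2 ^ n) *\<^sub>R axis i 1" for n
  \<comment> \<open>A quarter of the distance \<open>D\<close> of the centre from \<open>a\<close>.
    Later centres are at most half as far away, and \<open>D / 4 + D / 8 + D / 2 < D\<close> keeps
    the supports disjoint.\<close>
  define r where "r n = \<delta> / 2 ^ n / 4" for n
  define \<phi> where "\<phi> n = bump k (r n) (x n)" for n
  have r: "r n > 0" for n using \<delta> by (simp add: r_def)
  have xa: "dist (x n) a = \<delta> / 2 ^ n" for n
    using \<delta> by (simp add: x_def dist_norm norm_axis_1)
  have le\<delta>: "\<delta> / 2 ^ n \<le> \<delta>" for n
    using \<delta> by (simp add: divide_le_eq)
  have x: "x n \<in> \<Omega>" "T (\<lambda>y. c) (x n) \<noteq> 0" for n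
    using dx[of "x n"] xa[of n] le\<delta>[of n] \<delta> by (auto simp: \<delta>_def)
  have C\<phi>: "Ck_on k (\<phi> n) U" if "open U" for n U
    unfolding \<phi>_def using that by (rule Ck_on_bump)
  have \<phi>x: "\<phi> n (x n) > 0" for n unfolding \<phi>_def using r by (rule bump_center)
  have near: "dist y (x n) < r n" if "\<phi> n y \<noteq> 0" for n y
    using bump_eq_0[OF r[of n], of y "x n" k] that unfolding \<phi>_def by force
  have "\<phi> n y * \<phi> m y = 0" if "n < m" for n m y
  proof (rule ccontr)
    assume "\<phi> n y * \<phi> m y \<noteq> 0"
    then have "dist y (x n) < r n" "dist y (x m) < r m" using near by auto
    then have "dist (x n) a < r n + r m + dist (x m) a"
      using dist_triangle[of "x n" a y] dist_triangle[of y a "x m"] by (simp add: dist_commute)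
    moreover have "dist (x m) a \<le> dist (x n) a / 2"
    proof -
      have "(2::real) ^ Suc n \<le> 2 ^ m" using that by (intro power_increasing) auto
      then have "\<delta> / 2 ^ m \<le> \<delta> / 2 ^ Suc n" using \<delta> by (intro divide_left_mono) auto
      then show ?thesis by (simp add: xa)
    qed
    moreover have "r n = dist (x n) a / 4" "r m = dist (x m) a / 4" by (simp_all add: xa r_def)
    ultimately show False
      using r[of n] by linarith
  qed
  then have disj: "\<phi> n y * \<phi> m y = 0" if "n \<noteq> m" for n m y
    using that by (metis linorder_neqE_nat mult.commute)
  have supp: "\<phi> n y = 0" if "y \<notin> cball a (2 * \<delta>)" for n y
  proof (rule ccontr)
    assume "\<phi> n y \<noteq> 0"
    then have "dist y a < r n + \<delta> / 2 ^ n"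
      using near dist_triangle[of y a "x n"] xa[of n] by fastforce
    then show False using that le\<delta>[of n] \<delta> by (simp add: dist_commute r_def)
  qed
  obtain \<epsilon> where \<epsilon>: "\<And>n. \<epsilon> n > 0"
    and series: "\<And>\<alpha>. (\<forall>n. \<bar>\<alpha> n\<bar> \<le> \<epsilon> n) \<Longrightarrow> Ck_on k (\<lambda>x. \<Sum>n. \<alpha> n * \<phi> n x) UNIV"
    using Ck_on_series[of "cball a (2 * \<delta>)" k \<phi>, OF compact_cball C\<phi>[OF open_UNIV] supp] by blast
  have one: "T (\<lambda>y. 1) y = 0" if "y \<in> \<Omega>" for y
    using T_mult[OF C C that, of 1 1] A0[OF that] by simp
  \<comment> \<open>Three demands on the coefficient: the first bound makes the series
    \<open>C^k\<close>, the second keeps its product with \<open>T (\<phi> n) (x n)\<close> at most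
    1 in absolute value, and the lower bound makes the contribution of the constant at least
    \<open>n + 1\<close>. The surplus 1 pays for the second term.\<close>
  have "\<exists>b. \<bar>b\<bar> \<le> min (\<epsilon> n) (1 / (1 + \<bar>T (\<phi> n) (x n)\<bar>)) \<and> (real n + 1) / \<phi> n (x n) \<le> \<bar>T (\<lambda>y. b) (x n)\<bar>" for n
  proof -
    have e: "min (\<epsilon> n) (1 / (1 + \<bar>T (\<phi> n) (x n)\<bar>)) > 0" using \<epsilon>[of n] by (simp add: add_pos_nonneg)
    show ?thesis
      using additive_unbounded_near_0[of "\<lambda>b. T (\<lambda>y. b) (x n)", OF T_add[OF C C x(1)] one[OF x(1)] x(2) e]
      by metis
  qed
  then have "\<exists>\<alpha>. \<forall>n. \<bar>\<alpha> n\<bar> \<le> min (\<epsilon> n) (1 / (1 + \<bar>T (\<phi> n) (x n)\<bar>)) \<and> (real n + 1) / \<phi> n (x n) \<le> \<bar>T (\<lambda>y. \<alpha> n) (x n)\<bar>"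
    by (intro choice allI)
  then obtain \<alpha> where \<alpha>: "\<And>n. \<bar>\<alpha> n\<bar> \<le> \<epsilon> n" "\<And>n. \<bar>\<alpha> n\<bar> \<le> 1 / (1 + \<bar>T (\<phi> n) (x n)\<bar>)"
    "\<And>n. (real n + 1) / \<phi> n (x n) \<le> \<bar>T (\<lambda>y. \<alpha> n) (x n)\<bar>"
    by auto
  define F where "F y = (\<Sum>n. \<alpha> n * \<phi> n y)" for y
  have CF: "Ck_on k F \<Omega>"
    unfolding F_def[abs_def] using series[of \<alpha>] \<alpha>(1) Ck_on_subset by blast
  have big: "\<bar>T F (x n)\<bar> \<ge> real n" for n
  proof -
    have Cp: "Ck_on k (\<lambda>y. \<alpha> n * \<phi> n y) \<Omega>" by (intro Ck_on_cmult C\<phi> open_domain)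
    \<comment> \<open>The supports are disjoint, so \<open>F\<close> agrees with its
      \<open>n\<close>-th summand wherever \<open>\<phi> n\<close> is nonzero, in particular around
      \<open>x n\<close>.\<close>
    have "T (\<lambda>y. F y - \<alpha> n * \<phi> n y) (x n) = 0"
    proof (rule T_eq_0_if_annihilated[where p = "\<phi> n"])
      fix y
      show "(F y - \<alpha> n * \<phi> n y) * \<phi> n y = 0"
      proof (cases "\<phi> n y = 0")
        case False
        then have "\<phi> m y = 0" if "m \<noteq> n" for m using disj[OF that, of y] by simp
        then have "F y = (\<Sum>m\<in>{n}. \<alpha> m * \<phi> m y)"
          unfolding F_def by (intro suminf_finite) auto
        then show ?thesis by simp
      qed simp
    qed (use \<phi>x[of n] in \<open>auto intro: Ck_on_diff open_domain CF Cp C\<phi> x\<close>)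
    then have "T F (x n) = T (\<lambda>y. \<alpha> n * \<phi> n y) (x n)"
      using T_diff[OF CF Cp x(1)] by simp
    also have "\<dots> = \<alpha> n * T (\<phi> n) (x n) + \<phi> n (x n) * T (\<lambda>y. \<alpha> n) (x n)"
      using T_mult[OF C C\<phi>[OF open_domain] x(1)] A0[OF x(1)] by simp
    finally have "T F (x n) = \<alpha> n * T (\<phi> n) (x n) + \<phi> n (x n) * T (\<lambda>y. \<alpha> n) (x n)" .
    moreover have "\<bar>\<alpha> n * T (\<phi> n) (x n)\<bar> \<le> 1"
    proof -
      have "\<bar>\<alpha> n * T (\<phi> n) (x n)\<bar> \<le> 1 / (1 + \<bar>T (\<phi> n) (x n)\<bar>) * \<bar>T (\<phi> n) (x n)\<bar>"
        unfolding abs_mult by (intro mult_right_mono \<alpha>(2)) simp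
      also have "\<dots> \<le> 1" by (simp add: divide_le_eq add_pos_nonneg)
      finally show ?thesis .
    qed
    moreover have "\<bar>\<phi> n (x n) * T (\<lambda>y. \<alpha> n) (x n)\<bar> \<ge> real n + 1"
      using \<alpha>(3)[of n] \<phi>x[of n] by (simp add: abs_mult pos_divide_le_eq mult.commute)
    ultimately show ?thesis by linarith
  qed
  have "x \<longlonglongrightarrow> a"
  proof -
    have "(\<lambda>n. \<delta> * (1/2) ^ n) \<longlonglongrightarrow> \<delta> * 0"
      by (intro tendsto_mult_left LIMSEQ_power_zero) simp
    then have "(\<lambda>n. dist (x n) a) \<longlonglongrightarrow> 0" unfolding xa by (simp add: power_one_over)
    then show ?thesis by (rule tendsto_dist_iff[THEN iffD2])
  qed
  moreover have "isCont (T F) a"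
    using T_cont[OF CF] a open_domain by (simp add: continuous_on_eq_continuous_at)
  ultimately have "(\<lambda>n. T F (x n)) \<longlonglongrightarrow> T F a"
    by (rule isCont_tendsto_compose[rotated])
  then have "Bseq (\<lambda>n. T F (x n))" using convergent_imp_Bseq convergentI by blast
  then obtain B where B: "\<And>n. \<bar>T F (x n)\<bar> \<le> B" by (auto simp: Bseq_def)
  obtain n where "B < real n" using reals_Archimedean2 by blast
  then show False using B[of n] big[of n] by linarith
qed

end

subsection \<open>From the inversion identity to the Leibniz rules\<close>

text \<open>At a fixed point \<open>y\<close>, \<open>t\<close>, \<open>a\<close>, \<open>s\<close>,
  \<open>q\<close> stand for \<open>f\<close>, \<open>T f\<close>, \<open>A f\<close>,
  \<open>T (f * f)\<close>, \<open>A (f * f)\<close>. Multiplying by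
  \<open>y ^ 3 * (y + 1) ^ 3\<close> clears all denominators; the result is arranged by the defects
  \<open>s - 2 * y * t - 2 * a\<^sup>2\<close> and \<open>q - 2 * y * a\<close> of the two square
  rules.\<close>

lemma inversion_identity_polynomial:
  fixes y t a s q :: real
  assumes y: "y > 0"
    and eq: "- (1 / y\<^sup>2) * t + 2 / y ^ 3 * a\<^sup>2
      = (- (1 / (y + 1)\<^sup>2) * t + 2 / (y + 1) ^ 3 * a\<^sup>2)
        + (- (1 / (y * y + y)\<^sup>2) * (s + t) + 2 / (y * y + y) ^ 3 * (q + a)\<^sup>2)"
  shows "(s - 2 * y * t - 2 * a\<^sup>2) * (y * y + y)
    = 2 * (q - 2 * y * a)\<^sup>2 + 4 * (q - 2 * y * a) * a * (2 * y + 1)"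
proof -
  define z where "z = y + 1"
  have z: "z > 0" "y * y + y = y * z" using y by (auto simp: z_def algebra_simps)
  have "(- (1 / y\<^sup>2) * t + 2 / y ^ 3 * a\<^sup>2) * (y ^ 3 * z ^ 3) = - t * y * z ^ 3 + 2 * a\<^sup>2 * z ^ 3"
    using y z by (simp add: field_simps power2_eq_square power3_eq_cube)
  moreover have "(- (1 / z\<^sup>2) * t + 2 / z ^ 3 * a\<^sup>2) * (y ^ 3 * z ^ 3) = - t * z * y ^ 3 + 2 * a\<^sup>2 * y ^ 3"
    using y z by (simp add: field_simps power2_eq_square power3_eq_cube)
  moreover have "(- (1 / (y * z)\<^sup>2) * (s + t) + 2 / (y * z) ^ 3 * (q + a)\<^sup>2) * (y ^ 3 * z ^ 3)
      = - (s + t) * (y * z) + 2 * (q + a)\<^sup>2"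
    using y z by (simp add: field_simps power2_eq_square power3_eq_cube)
  moreover have "(- (1 / y\<^sup>2) * t + 2 / y ^ 3 * a\<^sup>2) * (y ^ 3 * z ^ 3)
      = ((- (1 / z\<^sup>2) * t + 2 / z ^ 3 * a\<^sup>2)
        + (- (1 / (y * z)\<^sup>2) * (s + t) + 2 / (y * z) ^ 3 * (q + a)\<^sup>2)) * (y ^ 3 * z ^ 3)"
    using eq unfolding z(2) z_def[symmetric] by (simp only:)
  ultimately have "- t * y * z ^ 3 + 2 * a\<^sup>2 * z ^ 3
      = - t * z * y ^ 3 + 2 * a\<^sup>2 * y ^ 3 + (- (s + t) * (y * z) + 2 * (q + a)\<^sup>2)"
    by (simp only: distrib_right)
  then show ?thesis unfolding z_def by algebra
qed

text \<open>With \<open>P\<close>, \<open>Q\<close>, \<open>a\<close> fixed, the difference of the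
  sides is a polynomial of degree at most 2 in the variable and has three distinct roots. Its
  coefficients give \<open>P = 0\<close>, then \<open>Q * a = 0\<close>, then
  \<open>Q = 0\<close>.\<close>

lemma quadratic_shift_vanish:
  fixes P Q a y :: real
  assumes "P * (y * y + y) = 2 * Q\<^sup>2 + 4 * Q * a * (2 * y + 1)"
    and "P * ((y + 1) * (y + 1) + (y + 1)) = 2 * Q\<^sup>2 + 4 * Q * a * (2 * (y + 1) + 1)"
    and "P * ((y + 1 + 1) * (y + 1 + 1) + (y + 1 + 1)) = 2 * Q\<^sup>2 + 4 * Q * a * (2 * (y + 1 + 1) + 1)"
  shows "P = 0" "Q = 0"
proof -
  show P: "P = 0" using assms by algebra
  have "Q * a = 0" using assms P by algebra
  then have "Q\<^sup>2 = 0" using assms(1) P by algebra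
  then show "Q = 0" by simp
qed

text \<open>The hypotheses restated for operators on total functions, so that the algebra is free of
  restricted abstractions.\<close>

locale inversion_pair =
  fixes \<Omega> :: "(real^'n) set" and k :: nat and T A :: "(real^'n \<Rightarrow> real) \<Rightarrow> real^'n \<Rightarrow> real"
  assumes open_domain: "open \<Omega>"
    and T_cong: "(\<And>y. y \<in> \<Omega> \<Longrightarrow> f y = g y) \<Longrightarrow> x \<in> \<Omega> \<Longrightarrow> T f x = T g x"
    and A_cong: "(\<And>y. y \<in> \<Omega> \<Longrightarrow> f y = g y) \<Longrightarrow> x \<in> \<Omega> \<Longrightarrow> A f x = A g x"
    and T_add: "Ck_on k f \<Omega> \<Longrightarrow> Ck_on k g \<Omega> \<Longrightarrow> x \<in> \<Omega> \<Longrightarrow> T (\<lambda>y. f y + g y) x = T f x + T g x"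
    and A_add: "Ck_on k f \<Omega> \<Longrightarrow> Ck_on k g \<Omega> \<Longrightarrow> x \<in> \<Omega> \<Longrightarrow> A (\<lambda>y. f y + g y) x = A f x + A g x"
    and A_one: "x \<in> \<Omega> \<Longrightarrow> A (\<lambda>y. 1) x = 0"
    and T_inverse: "Ck_on k f \<Omega> \<Longrightarrow> (\<And>y. y \<in> \<Omega> \<Longrightarrow> f y \<noteq> 0) \<Longrightarrow> x \<in> \<Omega> \<Longrightarrow>
      T (\<lambda>y. 1 / f y) x = - (1 / (f x)\<^sup>2) * T f x + 2 / (f x) ^ 3 * (A f x)\<^sup>2"
begin

lemmas C_intros = Ck_on_add[OF open_domain] Ck_on_mult[OF open_domain] Ck_on_const[OF open_domain]

lemma T_one: "x \<in> \<Omega> \<Longrightarrow> T (\<lambda>y. 1) x = 0"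
  using T_inverse[of "\<lambda>y. 1" x] A_one open_domain by simp

lemma add_one:
  assumes "Ck_on k f \<Omega>" "x \<in> \<Omega>"
  shows "T (\<lambda>y. f y + 1) x = T f x" "A (\<lambda>y. f y + 1) x = A f x"
  using T_add[OF assms(1) _ assms(2), of "\<lambda>y. 1"] A_add[OF assms(1) _ assms(2), of "\<lambda>y. 1"]
    T_one A_one assms(2) open_domain by simp_all

lemma square_add_one:
  assumes f: "Ck_on k f \<Omega>" and x: "x \<in> \<Omega>"
  shows "T (\<lambda>y. (f y + 1) * (f y + 1)) x = T (\<lambda>y. f y * f y) x + 2 * T f x"
    and "A (\<lambda>y. (f y + 1) * (f y + 1)) x = A (\<lambda>y. f y * f y) x + 2 * A f x"
proof -
  have *: "(\<lambda>y. (f y + 1) * (f y + 1)) = (\<lambda>y. (f y * f y + (f y + f y)) + 1)"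
    by (simp add: fun_eq_iff algebra_simps)
  have C: "Ck_on k (\<lambda>y. f y * f y) \<Omega>" "Ck_on k (\<lambda>y. f y + f y) \<Omega>"
    "Ck_on k (\<lambda>y. f y * f y + (f y + f y)) \<Omega>"
    by (intro C_intros f)+
  show "T (\<lambda>y. (f y + 1) * (f y + 1)) x = T (\<lambda>y. f y * f y) x + 2 * T f x"
    and "A (\<lambda>y. (f y + 1) * (f y + 1)) x = A (\<lambda>y. f y * f y) x + 2 * A f x"
    unfolding * using add_one[OF C(3) x] T_add[OF C(1,2) x] A_add[OF C(1,2) x] T_add[OF f f x] A_add[OF f f x]
    by simp_all
qed

text \<open>The functional equation applied to \<open>1 / f = 1 / (f + 1) + 1 / (f\<^sup>2 + f)\<close>.\<close>

lemma square_defects_relation: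
  assumes f: "Ck_on k f \<Omega>" and x: "x \<in> \<Omega>" and pos: "\<forall>y\<in>\<Omega>. f y > 0"
  shows "(T (\<lambda>y. f y * f y) x - 2 * f x * T f x - 2 * (A f x)\<^sup>2) * (f x * f x + f x)
    = 2 * (A (\<lambda>y. f y * f y) x - 2 * f x * A f x)\<^sup>2
      + 4 * (A (\<lambda>y. f y * f y) x - 2 * f x * A f x) * A f x * (2 * f x + 1)"
proof (rule inversion_identity_polynomial[OF pos[rule_format, OF x]])
  have C: "Ck_on k (\<lambda>y. f y * f y) \<Omega>" "Ck_on k (\<lambda>y. f y * f y + f y) \<Omega>" "Ck_on k (\<lambda>y. f y + 1) \<Omega>"
    by (intro C_intros f)+
  have p1: "f y + 1 \<noteq> 0" and p2: "f y * f y + f y \<noteq> 0" and p0: "f y \<noteq> 0" if "y \<in> \<Omega>" for y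
    using pos[rule_format, OF that] by (auto simp: add_pos_pos less_imp_neq[symmetric])
  have Ci: "Ck_on k (\<lambda>y. 1 / (f y + 1)) \<Omega>" "Ck_on k (\<lambda>y. 1 / (f y * f y + f y)) \<Omega>"
    using Ck_on_inverse[OF open_domain C(3) p1] Ck_on_inverse[OF open_domain C(2) p2]
    by (simp_all add: inverse_eq_divide)
  have "T (\<lambda>y. 1 / f y) x = T (\<lambda>y. 1 / (f y + 1) + 1 / (f y * f y + f y)) x"
  proof (rule T_cong[OF _ x])
    fix y assume "y \<in> \<Omega>"
    then show "1 / f y = 1 / (f y + 1) + 1 / (f y * f y + f y)"
      using pos[rule_format, of y] by (simp add: divide_simps add_pos_pos less_imp_neq[symmetric]) (simp add: algebra_simps)
  qed
  also have "\<dots> = T (\<lambda>y. 1 / (f y + 1)) x + T (\<lambda>y. 1 / (f y * f y + f y)) x"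
    by (rule T_add[OF Ci x])
  finally have E: "T (\<lambda>y. 1 / f y) x = T (\<lambda>y. 1 / (f y + 1)) x + T (\<lambda>y. 1 / (f y * f y + f y)) x" .
  show "- (1 / (f x)\<^sup>2) * T f x + 2 / (f x) ^ 3 * (A f x)\<^sup>2
      = (- (1 / (f x + 1)\<^sup>2) * T f x + 2 / (f x + 1) ^ 3 * (A f x)\<^sup>2)
        + (- (1 / (f x * f x + f x)\<^sup>2) * (T (\<lambda>y. f y * f y) x + T f x)
          + 2 / (f x * f x + f x) ^ 3 * (A (\<lambda>y. f y * f y) x + A f x)\<^sup>2)"
    using E T_inverse[OF f p0 x] T_inverse[OF C(3) p1 x] T_inverse[OF C(2) p2 x]
      add_one[OF f x] T_add[OF C(1) f x] A_add[OF C(1) f x] by (simp only:)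
qed

text \<open>Both defects are invariant under \<open>f + 1\<close>: as \<open>T\<close> and
  \<open>A\<close> kill 1, the image of the square grows by twice the image of \<open>f\<close>, and
  so does the term it is compared with. The same \<open>P\<close>, \<open>Q\<close> and
  \<open>A f x\<close> thus satisfy the relation at three consecutive arguments.\<close>

lemma square_rule:
  assumes f: "Ck_on k f \<Omega>" and x: "x \<in> \<Omega>" and pos: "\<forall>y\<in>\<Omega>. f y > 0"
  shows "T (\<lambda>y. f y * f y) x = 2 * f x * T f x + 2 * (A f x)\<^sup>2"
    and "A (\<lambda>y. f y * f y) x = 2 * f x * A f x"
proof -
  let ?P = "T (\<lambda>y. f y * f y) x - 2 * f x * T f x - 2 * (A f x)\<^sup>2"
  let ?Q = "A (\<lambda>y. f y * f y) x - 2 * f x * A f x"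
  have C1: "Ck_on k (\<lambda>y. f y + 1) \<Omega>" and C2: "Ck_on k (\<lambda>y. f y + 1 + 1) \<Omega>"
    by (intro C_intros f)+
  have pos1: "\<forall>y\<in>\<Omega>. f y + 1 > 0" and pos2: "\<forall>y\<in>\<Omega>. f y + 1 + 1 > 0"
    using pos by (auto simp: add_pos_pos)
  have e1: "?P * ((f x + 1) * (f x + 1) + (f x + 1)) = 2 * ?Q\<^sup>2 + 4 * ?Q * A f x * (2 * (f x + 1) + 1)"
    using square_defects_relation[OF C1 x pos1]
    unfolding square_add_one[OF f x] add_one[OF f x] by (simp add: algebra_simps)
  have e2: "?P * ((f x + 1 + 1) * (f x + 1 + 1) + (f x + 1 + 1)) = 2 * ?Q\<^sup>2 + 4 * ?Q * A f x * (2 * (f x + 1 + 1) + 1)"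
    using square_defects_relation[OF C2 x pos2]
    unfolding square_add_one[OF C1 x] add_one[OF C1 x] square_add_one[OF f x] add_one[OF f x]
    by (simp add: algebra_simps)
  note v = quadratic_shift_vanish[OF square_defects_relation[OF f x pos] e1 e2]
  show "T (\<lambda>y. f y * f y) x = 2 * f x * T f x + 2 * (A f x)\<^sup>2" using v(1) by simp
  show "A (\<lambda>y. f y * f y) x = 2 * f x * A f x" using v(2) by simp
qed

lemma mult_rule_positive:
  assumes f: "Ck_on k f \<Omega>" and g: "Ck_on k g \<Omega>" and x: "x \<in> \<Omega>"
    and pos: "\<forall>y\<in>\<Omega>. f y > 0" "\<forall>y\<in>\<Omega>. g y > 0"
  shows "T (\<lambda>y. f y * g y) x = f x * T g x + g x * T f x + 2 * A f x * A g x"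
    and "A (\<lambda>y. f y * g y) x = f x * A g x + g x * A f x"
proof -
  have C: "Ck_on k (\<lambda>y. f y + g y) \<Omega>" "Ck_on k (\<lambda>y. f y * g y) \<Omega>" "Ck_on k (\<lambda>y. f y * f y) \<Omega>"
    "Ck_on k (\<lambda>y. g y * g y) \<Omega>" "Ck_on k (\<lambda>y. f y * g y + f y * g y) \<Omega>"
    "Ck_on k (\<lambda>y. f y * f y + g y * g y) \<Omega>"
    by (intro C_intros f g)+
  have pfg: "\<forall>y\<in>\<Omega>. f y + g y > 0" using pos by (simp add: add_pos_pos)
  have *: "(\<lambda>y. (f y + g y) * (f y + g y)) = (\<lambda>y. (f y * f y + g y * g y) + (f y * g y + f y * g y))"
    by (simp add: fun_eq_iff algebra_simps)
  note S = square_rule[OF C(1) x pfg] square_rule[OF f x pos(1)] square_rule[OF g x pos(2)]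
  show "T (\<lambda>y. f y * g y) x = f x * T g x + g x * T f x + 2 * A f x * A g x"
    using S(1) unfolding * T_add[OF C(6,5) x] T_add[OF C(3,4) x] T_add[OF C(2,2) x] T_add[OF f g x]
      A_add[OF f g x] S(3,5) by algebra
  show "A (\<lambda>y. f y * g y) x = f x * A g x + g x * A f x"
    using S(2) unfolding * A_add[OF C(6,5) x] A_add[OF C(3,4) x] A_add[OF C(2,2) x]
      A_add[OF f g x] S(4,6) by algebra
qed

text \<open>Polynomials in \<open>f\<close> replace the positive and negative parts, which would
  lose differentiability.\<close>

lemma positive_decomposition:
  assumes "Ck_on k f \<Omega>"
  obtains p q where "Ck_on k p \<Omega>" "Ck_on k q \<Omega>" "\<forall>y\<in>\<Omega>. p y > 0" "\<forall>y\<in>\<Omega>. q y > 0" "\<And>y. f y + q y = p y"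
proof (rule that)
  show "Ck_on k (\<lambda>y. f y * f y + f y + 1) \<Omega>" "Ck_on k (\<lambda>y. f y * f y + 1) \<Omega>"
    by (intro C_intros assms)+
  have "f y * f y + f y + 1 > 0" for y
    using zero_le_power2[of "f y + 1 / 2"] by (simp add: power2_eq_square algebra_simps)
  then show "\<forall>y\<in>\<Omega>. f y * f y + f y + 1 > 0" by blast
  show "\<forall>y\<in>\<Omega>. f y * f y + 1 > 0" by (simp add: add_nonneg_pos)
qed simp

text \<open>Both sides are additive in \<open>f\<close>, so the rule passes to differences of
  positive functions; the second factor is freed in the same way afterwards.\<close>

lemma mult_rule_positive_right:
  assumes f: "Ck_on k f \<Omega>" and g: "Ck_on k g \<Omega>" and x: "x \<in> \<Omega>" and pos: "\<forall>y\<in>\<Omega>. g y > 0"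
  shows "T (\<lambda>y. f y * g y) x = f x * T g x + g x * T f x + 2 * A f x * A g x"
    and "A (\<lambda>y. f y * g y) x = f x * A g x + g x * A f x"
proof -
  obtain p q where pq: "Ck_on k p \<Omega>" "Ck_on k q \<Omega>" "\<forall>y\<in>\<Omega>. p y > 0" "\<forall>y\<in>\<Omega>. q y > 0" "\<And>y. f y + q y = p y"
    using positive_decomposition[OF f] by blast
  have p: "p = (\<lambda>y. f y + q y)" by (simp add: fun_eq_iff pq(5))
  have C: "Ck_on k (\<lambda>y. f y * g y) \<Omega>" "Ck_on k (\<lambda>y. q y * g y) \<Omega>"
    by (intro C_intros f g pq)+
  have pg: "(\<lambda>y. p y * g y) = (\<lambda>y. f y * g y + q y * g y)" by (simp add: p distrib_right)
  note P = mult_rule_positive[OF pq(1) g x pq(3) pos] and Q = mult_rule_positive[OF pq(2) g x pq(4) pos]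
  have Tp: "T p x = T f x + T q x" "A p x = A f x + A q x" "p x = f x + q x"
    unfolding p by (rule T_add[OF f pq(2) x] A_add[OF f pq(2) x] refl)+
  show "T (\<lambda>y. f y * g y) x = f x * T g x + g x * T f x + 2 * A f x * A g x"
    using P(1) unfolding pg T_add[OF C x] Q(1) Tp by algebra
  show "A (\<lambda>y. f y * g y) x = f x * A g x + g x * A f x"
    using P(2) unfolding pg A_add[OF C x] Q(2) Tp by algebra
qed

lemma mult_rule:
  assumes f: "Ck_on k f \<Omega>" and g: "Ck_on k g \<Omega>" and x: "x \<in> \<Omega>"
  shows "T (\<lambda>y. f y * g y) x = f x * T g x + g x * T f x + 2 * A f x * A g x"
    and "A (\<lambda>y. f y * g y) x = f x * A g x + g x * A f x"
proof -
  obtain p q where pq: "Ck_on k p \<Omega>" "Ck_on k q \<Omega>" "\<forall>y\<in>\<Omega>. p y > 0" "\<forall>y\<in>\<Omega>. q y > 0" "\<And>y. g y + q y = p y"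
    using positive_decomposition[OF g] by blast
  have p: "p = (\<lambda>y. g y + q y)" by (simp add: fun_eq_iff pq(5))
  have C: "Ck_on k (\<lambda>y. f y * g y) \<Omega>" "Ck_on k (\<lambda>y. f y * q y) \<Omega>"
    by (intro C_intros f g pq)+
  have pg: "(\<lambda>y. f y * p y) = (\<lambda>y. f y * g y + f y * q y)" by (simp add: p distrib_left)
  note P = mult_rule_positive_right[OF f pq(1) x pq(3)] and Q = mult_rule_positive_right[OF f pq(2) x pq(4)]
  have Tp: "T p x = T g x + T q x" "A p x = A g x + A q x" "p x = g x + q x"
    unfolding p by (rule T_add[OF g pq(2) x] A_add[OF g pq(2) x] refl)+
  show "T (\<lambda>y. f y * g y) x = f x * T g x + g x * T f x + 2 * A f x * A g x"
    using P(1) unfolding pg T_add[OF C x] Q(1) Tp by algebra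
  show "A (\<lambda>y. f y * g y) x = f x * A g x + g x * A f x"
    using P(2) unfolding pg A_add[OF C x] Q(2) Tp by algebra
qed

end

subsection \<open>Evaluation on Taylor polynomials\<close>

locale leibniz_pair_const = leibniz_pair +
  assumes A_const: "x \<in> \<Omega> \<Longrightarrow> A (\<lambda>y. c) x = 0"
begin

lemma T_const': "x \<in> \<Omega> \<Longrightarrow> T (\<lambda>y. c) x = 0"
  by (rule T_const[OF A_const])

lemma T_cmult: "Ck_on k f \<Omega> \<Longrightarrow> x \<in> \<Omega> \<Longrightarrow> T (\<lambda>y. c * f y) x = c * T f x"
  using T_mult[of "\<lambda>y. c" f x] T_const' A_const open_domain by simp

lemma T_sum:
  assumes "\<And>i. i \<in> I \<Longrightarrow> Ck_on k (g i) \<Omega>" "x \<in> \<Omega>"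
  shows "T (\<lambda>y. \<Sum>i\<in>I. g i y) x = (\<Sum>i\<in>I. T (g i) x)"
  using assms(1)
proof (induction I rule: infinite_finite_induct)
  case (insert i I)
  then show ?case
    using T_add[of "g i" "\<lambda>y. \<Sum>i\<in>I. g i y" x] assms(2) Ck_on_sum[OF open_domain, of I k g] by simp
qed (use assms(2) in \<open>simp_all add: T_const'\<close>)

lemma T_coord_diff:
  assumes "x \<in> \<Omega>"
  shows "T (\<lambda>y. (y - a) $ i) x = T (\<lambda>y. y $ i) x"
  using T_diff[OF Ck_on_coord[OF open_domain] Ck_on_const[OF open_domain] assms, of i "a $ i"]
    T_const'[OF assms] by simp

text \<open>The coordinate factors vanish at the expansion point, so of the three terms of the
  product rule only two survive.\<close>

lemma T_hterm_Suc:
  assumes x: "x \<in> \<Omega>"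
  shows "T (hterm x (Suc j) f) x = (\<Sum>i\<in>UNIV. hterm x j (pd i f) x * T (\<lambda>y. y $ i) x
      + 2 * A (\<lambda>y. (y - x) $ i) x * A (hterm x j (pd i f)) x) / real (Suc j)"
proof -
  note C = Ck_on_coord_diff[OF open_domain, of k x] Ck_on_hterm[OF open_domain, of k x j]
  have *: "hterm x (Suc j) f = (\<lambda>y. (1 / real (Suc j)) * (\<Sum>i\<in>UNIV. (y - x) $ i * hterm x j (pd i f) y))"
    by (simp add: fun_eq_iff)
  have "T (hterm x (Suc j) f) x
      = 1 / real (Suc j) * (\<Sum>i\<in>UNIV. T (\<lambda>y. (y - x) $ i * hterm x j (pd i f) y) x)"
    unfolding *
    by (subst T_cmult[OF Ck_on_sum[OF open_domain Ck_on_mult[OF open_domain C]] x],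
        subst T_sum[OF Ck_on_mult[OF open_domain C] x]) (rule refl)
  also have "\<dots> = (\<Sum>i\<in>UNIV. hterm x j (pd i f) x * T (\<lambda>y. y $ i) x
      + 2 * A (\<lambda>y. (y - x) $ i) x * A (hterm x j (pd i f)) x) / real (Suc j)"
    using T_mult[OF C x] T_coord_diff[OF x] by simp
  finally show ?thesis .
qed

lemma T_hterm_0: "x \<in> \<Omega> \<Longrightarrow> T (hterm x 0 f) x = 0"
  using T_const'[of x "f x"] by (simp add: hterm.simps(1)[abs_def])

lemma T_taylor:
  assumes f: "Ck_on k f \<Omega>" and x: "x \<in> \<Omega>"
  shows "T f x = (\<Sum>j\<le>k. T (hterm x j f) x)"
proof -
  note C = Ck_on_hterm[OF open_domain, of k x]
  have S: "Ck_on k (\<lambda>y. \<Sum>j\<le>k. hterm x j f y) \<Omega>"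
    by (intro Ck_on_sum C open_domain)
  have "T (\<lambda>y. f y - (\<Sum>j\<le>k. hterm x j f y)) x = 0"
    by (rule T_flat[OF Ck_on_diff[OF open_domain f S] x flat_taylor[OF open_domain x f]])
  then show ?thesis using T_diff[OF f S x] T_sum[OF C x] by simp
qed

end

lemma sum_atMost_only_1:
  fixes h :: "nat \<Rightarrow> real"
  assumes "h 0 = 0" "\<And>j. h (Suc (Suc j)) = 0"
  shows "(\<Sum>j\<le>k. h j) = (if k \<ge> 1 then h 1 else 0)"
proof -
  have "(\<Sum>j\<le>k. h j) = (\<Sum>j\<le>k. if j = 1 then h 1 else 0)"
  proof (rule sum.cong)
    show "h j = (if j = 1 then h 1 else 0)" for j
      using assms by (cases j; cases "j - 1") auto
  qed simp
  then show ?thesis by simp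
qed

lemma sum_atMost_only_1_2:
  fixes h :: "nat \<Rightarrow> real"
  assumes "h 0 = 0" "\<And>j. h (Suc (Suc (Suc j))) = 0"
  shows "(\<Sum>j\<le>k. h j) = (if k \<ge> 2 then h 2 else 0) + (if k \<ge> 1 then h 1 else 0)"
proof -
  have "(\<Sum>j\<le>k. h j) = (\<Sum>j\<le>k. (if j = 2 then h 2 else 0) + (if j = 1 then h 1 else 0))"
  proof (rule sum.cong)
    show "h j = (if j = 2 then h 2 else 0) + (if j = 1 then h 1 else 0)" for j
      using assms by (cases j; cases "j - 1"; cases "j - 2") (auto simp: numeral_2_eq_2)
  qed simp
  then show ?thesis by (simp add: sum.distrib)
qed

lemma grad_inner: "grad f x \<bullet> v = (\<Sum>i\<in>UNIV. pd i f x * v $ i)"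
  by (simp add: grad_def inner_vec_def)

lemma hessian_component:
  fixes f :: "real^'n \<Rightarrow> real"
  assumes "Ck_on 2 f \<Omega>" "x \<in> \<Omega>"
  shows "hessian f x $ i $ l = pd l (pd i f) x"
proof -
  have "Ck_on (Suc 0) (pd i f) \<Omega>" for i
    using assms(1) unfolding numeral_2_eq_2 by (simp only: Ck_on.simps(2)[of "Suc 0"])
  then have d: "(pd i f has_derivative frechet_derivative (pd i f) (at x)) (at x)" for i
    using assms(2) by (rule Ck_on_Suc_has_derivative)
  have "(grad f has_derivative (\<lambda>v. \<chi> i. frechet_derivative (pd i f) (at x) v)) (at x)"
    unfolding has_derivative_componentwise_within[of "grad f"]
    using d by (auto simp: Basis_vec_def inner_axis grad_def)
  from frechet_derivative_at[OF this, symmetric] show ?thesis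
    by (simp add: hessian_def jacobian_def matrix_def)
qed

section \<open>Closed formulas for both operators\<close>

locale second_order_pair =
  TA: leibniz_pair \<Omega> k T A + A0: leibniz_pair \<Omega> k A "\<lambda>_ _. 0"
  for \<Omega> :: "(real^'n) set" and k T A

text \<open>The order matters: for \<open>(A, 0)\<close> the second operator kills constants
  trivially, so \<open>A\<close> kills them by the gliding hump, and this is the assumption under
  which the same argument applies to \<open>T\<close>.\<close>

sublocale second_order_pair \<subseteq> A0: leibniz_pair_const \<Omega> k A "\<lambda>_ _. 0"
  by unfold_locales simp

sublocale second_order_pair \<subseteq> TA: leibniz_pair_const \<Omega> k T A
  by unfold_locales (rule A0.T_const')

context second_order_pair
begin

text \<open>For \<open>k > 0\<close> these values are forced by the claimed formulas, since
  coordinate functions have a unit vector as gradient and zero Hessian.\<close>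

definition b :: "real^'n \<Rightarrow> real^'n" where "b x = (\<chi> i. T (\<lambda>y. y $ i) x)"
definition c :: "real^'n \<Rightarrow> real^'n" where "c x = (\<chi> i. A (\<lambda>y. y $ i) x)"

lemma continuous_on_b: "continuous_on \<Omega> b" and continuous_on_c: "continuous_on \<Omega> c"
  unfolding b_def[abs_def] c_def[abs_def]
  by (intro continuous_on_vec_lambda TA.T_cont A0.T_cont Ck_on_coord TA.open_domain)+

text \<open>The recursion for \<open>(A, 0)\<close> has no cross term, so degree
  \<open>j + 1\<close> is weighted by the value at \<open>x\<close> of terms of degree
  \<open>j\<close>, which is zero for \<open>j > 0\<close>.\<close>

lemma A_hterm:
  assumes "x \<in> \<Omega>"
  shows "A (hterm x 0 f) x = 0" "A (hterm x 1 f) x = grad f x \<bullet> c x" "A (hterm x (Suc (Suc j)) f) x = 0"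
proof -
  show "A (hterm x 0 f) x = 0" by (rule A0.T_hterm_0[OF assms])
  show "A (hterm x 1 f) x = grad f x \<bullet> c x"
    using A0.T_hterm_Suc[OF assms, of 0 f] by (simp add: grad_inner c_def del: hterm.simps(2))
  show "A (hterm x (Suc (Suc j)) f) x = 0"
    unfolding A0.T_hterm_Suc[OF assms, of "Suc j" f] hterm_Suc_at by simp
qed

lemma A_formula:
  assumes "Ck_on k f \<Omega>" "x \<in> \<Omega>"
  shows "A f x = (if k \<ge> 1 then grad f x \<bullet> c x else 0)"
  using A0.T_taylor[OF assms] sum_atMost_only_1[of "\<lambda>j. A (hterm x j f) x" k] A_hterm[OF assms(2)]
  by simp

lemma T_hterm_1:
  assumes "x \<in> \<Omega>"
  shows "T (hterm x 1 f) x = grad f x \<bullet> b x"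
  using TA.T_hterm_Suc[OF assms, of 0 f] A_hterm(1)[OF assms]
  by (simp add: grad_inner b_def del: hterm.simps(2))

text \<open>The linear terms vanish at \<open>x\<close>, so only cross terms remain; their factor 2
  cancels the 1/2 of the quadratic Taylor term, and the Hessian form appears without a
  constant.\<close>

lemma T_hterm_2:
  assumes "x \<in> \<Omega>" and "Ck_on 2 f \<Omega>"
  shows "T (hterm x 2 f) x = (hessian f x *v c x) \<bullet> c x"
proof -
  have "T (hterm x 2 f) x = (\<Sum>i\<in>UNIV. 2 * c x $ i * A (hterm x 1 (pd i f)) x) / 2"
    using TA.T_hterm_Suc[OF assms(1), of 1 f] A0.T_coord_diff[OF assms(1)]
    by (simp add: c_def numeral_2_eq_2 del: hterm.simps(2))
  also have "\<dots> = (\<Sum>i\<in>UNIV. c x $ i * (\<Sum>l\<in>UNIV. pd l (pd i f) x * c x $ l))"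
    unfolding A_hterm(2)[OF assms(1)] grad_inner by (simp add: sum_divide_distrib)
  also have "\<dots> = (hessian f x *v c x) \<bullet> c x"
    by (simp add: inner_vec_def matrix_vector_mult_def hessian_component[OF assms(2,1)] mult.commute)
  finally show ?thesis .
qed

lemma T_hterm_ge_3:
  assumes "x \<in> \<Omega>"
  shows "T (hterm x (Suc (Suc (Suc j))) f) x = 0"
  unfolding TA.T_hterm_Suc[OF assms, of "Suc (Suc j)" f] hterm_Suc_at A_hterm(3)[OF assms] by simp

lemma T_formula:
  assumes "Ck_on k f \<Omega>" "x \<in> \<Omega>"
  shows "T f x = (if k \<ge> 2 then (hessian f x *v c x) \<bullet> c x else 0) + (if k \<ge> 1 then grad f x \<bullet> b x else 0)"
proof -
  have "T f x = (if k \<ge> 2 then T (hterm x 2 f) x else 0) + (if k \<ge> 1 then T (hterm x 1 f) x else 0)"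
    unfolding TA.T_taylor[OF assms]
    by (rule sum_atMost_only_1_2) (use assms(2) in \<open>simp_all only: TA.T_hterm_0 T_hterm_ge_3\<close>)
  then show ?thesis
    using T_hterm_1[OF assms(2)] T_hterm_2[OF assms(2) Ck_on_mono[OF assms(1)]] by simp
qed

text \<open>The square of a coordinate vanishing at \<open>x\<close> is flat to first order, yet \<open>T\<close> maps it to \<open>2 c\<^sub>i\<^sup>2\<close> at \<open>x\<close>.\<close>

lemma c_eq_0:
  assumes "k \<le> 1" "x \<in> \<Omega>"
  shows "c x = 0"
proof -
  have "c x $ i = 0" for i
  proof -
    let ?s = "\<lambda>y. (y - x) $ i"
    have C: "Ck_on k ?s \<Omega>" by (rule Ck_on_coord_diff[OF TA.open_domain])
    have "((\<lambda>y. ?s y * ?s y) has_derivative (\<lambda>v. ?s x * v $ i + v $ i * ?s x)) (at x)"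
      by (intro has_derivative_mult has_derivative_coord_diff)
    from frechet_derivative_at[OF this, symmetric] have "flat k (\<lambda>y. ?s y * ?s y) x"
      using assms(1) by (cases k) simp_all
    then have "T (\<lambda>y. ?s y * ?s y) x = 0"
      by (intro TA.T_flat Ck_on_mult TA.open_domain C assms(2))
    then have "A ?s x = 0" using TA.T_mult[OF C C assms(2)] by simp
    then show ?thesis using A0.T_coord_diff[OF assms(2), of x i] by (simp add: c_def)
  qed
  then show ?thesis by (simp add: vec_eq_iff)
qed

end

section \<open>Transfer from extensional functions to operators on total functions\<close>

theorem theorem4:
  fixes \<Omega> :: "(real^'n) set" and k :: nat
    and T A :: "(real^'n \<Rightarrow> real) \<Rightarrow> (real^'n \<Rightarrow> real)"
  assumes "\<Omega> \<noteq> {}" and "open \<Omega>" and "connected \<Omega>"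
    and "T \<in> Ck k \<Omega> \<rightarrow> Ck 0 \<Omega>" and "A \<in> Ck k \<Omega> \<rightarrow> Ck 0 \<Omega>"
    and "additive_Ck k \<Omega> T" and "additive_Ck k \<Omega> A"
    and "A (\<lambda>x\<in>\<Omega>. 1) = (\<lambda>x\<in>\<Omega>. 0)"
    and "\<And>f. f \<in> Ck k \<Omega> \<Longrightarrow> (\<forall>x\<in>\<Omega>. f x \<noteq> 0) \<Longrightarrow>
           T (\<lambda>x\<in>\<Omega>. 1 / f x) =
             (\<lambda>x\<in>\<Omega>. - (1 / (f x)^2) * T f x + 2 / (f x)^3 * (A f x)^2)"
  shows "\<exists>b c :: real^'n \<Rightarrow> real^'n.
           continuous_on \<Omega> b \<and> continuous_on \<Omega> c \<and>
           (\<forall>f\<in>Ck k \<Omega>. \<forall>x\<in>\<Omega>.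
              T f x = (if k \<ge> 2 then (hessian f x *v c x) \<bullet> c x else 0)
                    + (if k \<ge> 1 then grad f x \<bullet> b x else 0) \<and>
              A f x = (if k \<ge> 1 then grad f x \<bullet> c x else 0)) \<and>
           (k = 1 \<longrightarrow> (\<forall>x\<in>\<Omega>. c x = 0)) \<and>
           (k = 0 \<longrightarrow> (\<forall>x\<in>\<Omega>. b x = 0) \<and> (\<forall>x\<in>\<Omega>. c x = 0))"
proof -
  note o = \<open>open \<Omega>\<close>
  have mem: "restrict f \<Omega> \<in> Ck k \<Omega>" if "Ck_on k f \<Omega>" for f
    using that Ck_on_cong[OF o, of "restrict f \<Omega>" f k] by (simp add: Ck_def)
  have restrict_eq: "restrict f \<Omega> = f" if "f \<in> Ck k \<Omega>" for f
    using that by (simp add: Ck_def extensional_restrict)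
  have add: "S (\<lambda>y\<in>\<Omega>. f y + g y) x = S (restrict f \<Omega>) x + S (restrict g \<Omega>) x"
    if "additive_Ck k \<Omega> S" "Ck_on k f \<Omega>" "Ck_on k g \<Omega>" "x \<in> \<Omega>" for S :: "(real^'n \<Rightarrow> real) \<Rightarrow> real^'n \<Rightarrow> real" and f g x
  proof -
    have *: "(\<lambda>y\<in>\<Omega>. restrict f \<Omega> y + restrict g \<Omega> y) = (\<lambda>y\<in>\<Omega>. f y + g y)" by auto
    have "S (\<lambda>y\<in>\<Omega>. restrict f \<Omega> y + restrict g \<Omega> y) = (\<lambda>y\<in>\<Omega>. S (restrict f \<Omega>) y + S (restrict g \<Omega>) y)"
      using that(1) mem[OF that(2)] mem[OF that(3)] unfolding additive_Ck_def by blast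
    then show ?thesis unfolding * using that(4) by simp
  qed
  have cont: "continuous_on \<Omega> (S (restrict f \<Omega>))" if "S \<in> Ck k \<Omega> \<rightarrow> Ck 0 \<Omega>" "Ck_on k f \<Omega>" for S f
    using that mem[OF that(2)] by (auto simp: Ck_def)
  \<comment> \<open>\<open>Ck\<close> admits only functions that are \<open>undefined\<close> off
    \<open>\<Omega>\<close>; composing with restriction accepts total functions and leaves the
    operators unchanged on members of \<open>Ck k \<Omega>\<close>.\<close>
  let ?T = "\<lambda>f. T (restrict f \<Omega>)" and ?A = "\<lambda>f. A (restrict f \<Omega>)"
  have cong: "S (restrict f \<Omega>) x = S (restrict g \<Omega>) x" if "\<And>y. y \<in> \<Omega> \<Longrightarrow> f y = g y"
    for f g and S :: "(real^'n \<Rightarrow> real) \<Rightarrow> real^'n \<Rightarrow> real" and x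
  proof -
    have "restrict f \<Omega> = restrict g \<Omega>" using that by (rule restrict_ext)
    then show ?thesis by simp
  qed
  interpret I: inversion_pair \<Omega> k ?T ?A
  proof
    show "open \<Omega>" by (rule o)
    show "?T f x = ?T g x" if "\<And>y. y \<in> \<Omega> \<Longrightarrow> f y = g y" "x \<in> \<Omega>" for f g x
      by (rule cong) (rule that(1))
    show "?A f x = ?A g x" if "\<And>y. y \<in> \<Omega> \<Longrightarrow> f y = g y" "x \<in> \<Omega>" for f g x
      by (rule cong) (rule that(1))
    show "?T (\<lambda>y. f y + g y) x = ?T f x + ?T g x" if "Ck_on k f \<Omega>" "Ck_on k g \<Omega>" "x \<in> \<Omega>" for f g x
      by (rule add[OF assms(6) that])
    show "?A (\<lambda>y. f y + g y) x = ?A f x + ?A g x" if "Ck_on k f \<Omega>" "Ck_on k g \<Omega>" "x \<in> \<Omega>" for f g x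
      by (rule add[OF assms(7) that])
    show "?A (\<lambda>y. 1) x = 0" if "x \<in> \<Omega>" for x
      using assms(8) that by simp
    show "?T (\<lambda>y. 1 / f y) x = - (1 / (f x)\<^sup>2) * ?T f x + 2 / (f x) ^ 3 * (?A f x)\<^sup>2"
      if "Ck_on k f \<Omega>" "\<And>y. y \<in> \<Omega> \<Longrightarrow> f y \<noteq> 0" "x \<in> \<Omega>" for f x
    proof -
      have "(\<lambda>y\<in>\<Omega>. 1 / restrict f \<Omega> y) = (\<lambda>y\<in>\<Omega>. 1 / f y)" by auto
      then show ?thesis
        using assms(9)[OF mem[OF that(1)]] that(2,3) by simp
    qed
  qed
  have "leibniz_pair \<Omega> k ?T ?A"
  proof
    show "continuous_on \<Omega> (?T f)" if "Ck_on k f \<Omega>" for f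
      by (rule cont[OF assms(4) that])
  qed (rule o I.T_cong I.A_cong I.T_add I.mult_rule; assumption)+
  moreover have "leibniz_pair \<Omega> k ?A (\<lambda>_ _. 0)"
  proof
    show "continuous_on \<Omega> (?A f)" if "Ck_on k f \<Omega>" for f
      by (rule cont[OF assms(5) that])
    show "?A (\<lambda>y. f y * g y) x = f x * ?A g x + g x * ?A f x + 2 * 0 * 0"
      if "Ck_on k f \<Omega>" "Ck_on k g \<Omega>" "x \<in> \<Omega>" for f g x
      using I.mult_rule(2)[OF that] by simp
  qed (simp | rule o I.A_cong I.A_add; assumption)+
  ultimately interpret second_order_pair \<Omega> k ?T ?A
    by (rule second_order_pair.intro)
  show ?thesis
  proof (intro exI conjI)
    \<comment> \<open>For \<open>k = 0\<close> the gradient term is absent from the formula, so the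
      zero field can be supplied as the required \<open>b\<close>.\<close>
    show "continuous_on \<Omega> (if k = 0 then (\<lambda>x. 0) else b)" using continuous_on_b by simp
    show "continuous_on \<Omega> c" by (rule continuous_on_c)
    show "\<forall>f\<in>Ck k \<Omega>. \<forall>x\<in>\<Omega>.
        T f x = (if k \<ge> 2 then (hessian f x *v c x) \<bullet> c x else 0)
          + (if k \<ge> 1 then grad f x \<bullet> (if k = 0 then (\<lambda>x. 0) else b) x else 0) \<and>
        A f x = (if k \<ge> 1 then grad f x \<bullet> c x else 0)"
    proof (intro ballI)
      fix f x assume f: "f \<in> Ck k \<Omega>" and x: "x \<in> \<Omega>"
      then have C: "Ck_on k f \<Omega>" by (simp add: Ck_def)
      show "T f x = (if k \<ge> 2 then (hessian f x *v c x) \<bullet> c x else 0)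
          + (if k \<ge> 1 then grad f x \<bullet> (if k = 0 then (\<lambda>x. 0) else b) x else 0) \<and>
        A f x = (if k \<ge> 1 then grad f x \<bullet> c x else 0)"
        using T_formula[OF C x] A_formula[OF C x] unfolding restrict_eq[OF f] by simp
    qed
  qed (use c_eq_0 in auto)
qed

end
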